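(* Let $\mu$ be a doubling measure on $X$ and $\Omega$ supports a local $\Phi$-Poincaré inequality for some N-function $\Phi\in\Delta'\cap\nabla_2$. For every $m\in\mathbb N$, let $(Y_m,d_m)$ be a complete metric space, $K_m\subset Y_m$ compact and $\{u_m\}\subset M^{1,\Phi}(\Omega,Y_m)$. Suppose that $(K_m,d_m)$ is a uniformly compact sequence and \begin{equation*} \sup_{m\in\mathbb N}\left[\|d_m(y_m,u_m)\|_{L^\Phi(\Omega)}+E_H^\Phi(u_m)\right]<\infty \end{equation*} for some and thus every $y_m\in K_m$. Then, after possibly passing to a subsequence, there exist a complete metric space $Z$, isometric embeddings $\varphi_m\colon Y_m\hookrightarrow Z$, a compact subset $K\subset Z$ and $v\in M^{1,\Phi}(\Omega,Z)$ such that $\varphi_m(K_m)\subset K$ for all $m\in\mathbb N$ and $\varphi_m\circ u_m$ converges to $v$ in $L^\Phi(\Omega,Z)$.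
   Context: Setting: $X=(X,d_X,\mu)$ complete metric measure space, $\Omega\subset X$ bounded domain; $\mu$ doubling means $0<\mu(B(x,2r))\le C_d\mu(B(x,r))<\infty$. An N-function is a continuous even convex $\Phi\colon\mathbb R\to[0,\infty)$ with $\Phi(x)=0$ iff $x=0$, $\Phi(x)/x\to0$ as $x\to0$, $\to\infty$ as $x\to\infty$. $\Phi\in\Delta'$: $\Phi(xy)\le C'\Phi(x)\Phi(y)$; $\Phi\in\nabla_2$: $\Phi(x)\le\frac1{2C}\Phi(Cx)$ for some $C>1$. Local $\Phi$-Poincaré inequality: there are $C_\Phi>0,\lambda\ge1$ such that $\frac{1}{\mu(B)}\int_B|u-u_B|\,d\mu\le C_\Phi r\,\Phi^{-1}\!\left(\frac{1}{\mu(\lambda B)}\int_{\lambda B}\Phi(g)\,d\mu\right)$ for every integrable $u$, every upper gradient $g$, and each ball $B=B(x,r)$ with $\lambda B\subset\Omega$, $u_B=\frac1{\mu(B)}\int_Bu\,d\mu$. $L^\Phi$ carries the Luxemburg norm. $M^{1,\Phi}(\Omega,Y)$ consists of measurable $u\in L^\Phi(\Omega,Y)$ for which there exists $0\le g\in L^\Phi(\Omega)$ with $d_Y(u(x),u(x'))\le d_X(x,x')(g(x)+g(x'))$ for all $x,x'$ outside a $\mu$-null set; $E_H^\Phi(u)=\inf_g\|g\|_{L^\Phi(\Omega)}$ over such $g$. Uniformly compact: $\sup_m\operatorname{diam}K_m<\infty$ and for each $\varepsilon>0$ there is $N$ such that every $K_m$ is covered by at most $N$ balls of radius $\varepsilon$.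 *)

theory Defs
  imports "HOL-Analysis.Analysis"
begin

definition doubling_measure :: "'x::metric_space measure \<Rightarrow> bool" where
  "doubling_measure \<mu> \<longleftrightarrow> (\<exists>Cd. \<forall>x r. r > 0 \<longrightarrow>
      0 < emeasure \<mu> (ball x r) \<and> emeasure \<mu> (ball x (2*r)) < \<infinity> \<and>
      emeasure \<mu> (ball x (2*r)) \<le> ennreal Cd * emeasure \<mu> (ball x r))"

definition curve_length :: "(real \<Rightarrow> 'x::metric_space) \<Rightarrow> real \<Rightarrow> real \<Rightarrow> ennreal" where
  "curve_length \<gamma> a b = (SUP p \<in> {(n, t). t 0 = a \<and> t n = b \<and> (\<forall>i<n. t i \<le> t (Suc i))}.
      ennreal (\<Sum>i<fst p. dist (\<gamma> (snd p i)) (\<gamma> (snd p (Suc i)))))"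

definition rectifiable_curve_in :: "'x::metric_space set \<Rightarrow> (real \<Rightarrow> 'x) \<Rightarrow> real \<Rightarrow> real \<Rightarrow> bool" where
  "rectifiable_curve_in \<Omega> \<gamma> a b \<longleftrightarrow> a \<le> b \<and> continuous_on {a..b} \<gamma> \<and> \<gamma> ` {a..b} \<subseteq> \<Omega>
      \<and> curve_length \<gamma> a b < \<infinity>"

definition arclength_fun :: "(real \<Rightarrow> 'x::metric_space) \<Rightarrow> real \<Rightarrow> real \<Rightarrow> real \<Rightarrow> real" where
  "arclength_fun \<gamma> a b = (\<lambda>t. enn2real (curve_length \<gamma> a (max a (min t b))))"

definition line_integral :: "(real \<Rightarrow> 'x::metric_space) \<Rightarrow> real \<Rightarrow> real \<Rightarrow> ('x \<Rightarrow> real) \<Rightarrow> ennreal" where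
  "line_integral \<gamma> a b g = (\<integral>\<^sup>+ t \<in> {a..b}. ennreal (g (\<gamma> t)) \<partial>interval_measure (arclength_fun \<gamma> a b))"

definition upper_gradient :: "'x::metric_space set \<Rightarrow> ('x \<Rightarrow> real) \<Rightarrow> ('x \<Rightarrow> real) \<Rightarrow> bool" where
  "upper_gradient \<Omega> u g \<longleftrightarrow> g \<in> borel_measurable borel \<and> (\<forall>x. 0 \<le> g x) \<and>
     (\<forall>\<gamma> a b. rectifiable_curve_in \<Omega> \<gamma> a b \<longrightarrow>
        ennreal \<bar>u (\<gamma> a) - u (\<gamma> b)\<bar> \<le> line_integral \<gamma> a b g)"

definition N_function :: "(real \<Rightarrow> real) \<Rightarrow> bool" where
  "N_function \<Phi> \<longleftrightarrow> continuous_on UNIV \<Phi> \<and> (\<forall>x. \<Phi> (-x) = \<Phi> x) \<and> convex_on UNIV \<Phi> \<and>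
     (\<forall>x. 0 \<le> \<Phi> x) \<and> (\<forall>x. \<Phi> x = 0 \<longleftrightarrow> x = 0) \<and>
     ((\<lambda>x. \<Phi> x / x) \<longlongrightarrow> 0) (at 0) \<and> filterlim (\<lambda>x. \<Phi> x / x) at_top at_top"

definition Delta_prime :: "(real \<Rightarrow> real) \<Rightarrow> bool" where
  "Delta_prime \<Phi> \<longleftrightarrow> (\<exists>C'. \<forall>x y. \<Phi> (x*y) \<le> C' * \<Phi> x * \<Phi> y)"

definition nabla2 :: "(real \<Rightarrow> real) \<Rightarrow> bool" where
  "nabla2 \<Phi> \<longleftrightarrow> (\<exists>C>1. \<forall>x. \<Phi> x \<le> \<Phi> (C*x) / (2*C))"

definition Phi_inv :: "(real \<Rightarrow> real) \<Rightarrow> real \<Rightarrow> real" where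
  "Phi_inv \<Phi> = the_inv_into {0..} \<Phi>"

definition avg :: "'x measure \<Rightarrow> 'x set \<Rightarrow> ('x \<Rightarrow> real) \<Rightarrow> real" where
  "avg \<mu> B f = (LINT y:B|\<mu>. f y) / measure \<mu> B"

definition supports_Phi_Poincare :: "'x::metric_space measure \<Rightarrow> 'x set \<Rightarrow> (real \<Rightarrow> real) \<Rightarrow> bool" where
  "supports_Phi_Poincare \<mu> \<Omega> \<Phi> \<longleftrightarrow> (\<exists>C\<^sub>\<Phi>>0. \<exists>lam\<ge>1. \<forall>u g x r.
      r > 0 \<and> ball x (lam*r) \<subseteq> \<Omega> \<and> set_integrable \<mu> \<Omega> u \<and> upper_gradient \<Omega> u g \<and>
      (\<integral>\<^sup>+ y \<in> ball x (lam*r). ennreal (\<Phi> (g y)) \<partial>\<mu>) < \<infinity> \<longrightarrow>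
      avg \<mu> (ball x r) (\<lambda>y. \<bar>u y - avg \<mu> (ball x r) u\<bar>)
        \<le> C\<^sub>\<Phi> * r * Phi_inv \<Phi> (enn2real (\<integral>\<^sup>+ y \<in> ball x (lam*r). ennreal (\<Phi> (g y)) \<partial>\<mu>)
                                    / measure \<mu> (ball x (lam*r))))"

text \<open>Luxemburg norm (value \<infinity> if f is not in the Orlicz space)\<close>
definition lux_norm :: "'x measure \<Rightarrow> 'x set \<Rightarrow> (real \<Rightarrow> real) \<Rightarrow> ('x \<Rightarrow> real) \<Rightarrow> ennreal" where
  "lux_norm \<mu> \<Omega> \<Phi> f = (INF k \<in> {k::real. k > 0 \<and> (\<integral>\<^sup>+ x \<in> \<Omega>. ennreal (\<Phi> (\<bar>f x\<bar> / k)) \<partial>\<mu>) \<le> 1}. ennreal k)"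

definition in_LPhi :: "'x measure \<Rightarrow> 'x set \<Rightarrow> (real \<Rightarrow> real) \<Rightarrow> ('x \<Rightarrow> real) \<Rightarrow> bool" where
  "in_LPhi \<mu> \<Omega> \<Phi> f \<longleftrightarrow> f \<in> borel_measurable (restrict_space \<mu> \<Omega>) \<and> lux_norm \<mu> \<Omega> \<Phi> f < \<infinity>"

definition borel_of_metric :: "'y metric \<Rightarrow> 'y measure" where
  "borel_of_metric Y = sigma (mspace Y) {U. openin (mtopology_of Y) U}"

definition in_LPhi_map :: "'x measure \<Rightarrow> 'x set \<Rightarrow> (real \<Rightarrow> real) \<Rightarrow> 'y metric \<Rightarrow> ('x \<Rightarrow> 'y) \<Rightarrow> bool" where
  "in_LPhi_map \<mu> \<Omega> \<Phi> Y u \<longleftrightarrow> u ` \<Omega> \<subseteq> mspace Y \<and>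
     u \<in> measurable (restrict_space \<mu> \<Omega>) (borel_of_metric Y) \<and>
     (\<exists>y0 \<in> mspace Y. lux_norm \<mu> \<Omega> \<Phi> (\<lambda>x. mdist Y y0 (u x)) < \<infinity>)"

definition hajlasz_gradient :: "'x::metric_space measure \<Rightarrow> 'x set \<Rightarrow> (real \<Rightarrow> real) \<Rightarrow> 'y metric \<Rightarrow> ('x \<Rightarrow> 'y) \<Rightarrow> ('x \<Rightarrow> real) \<Rightarrow> bool" where
  "hajlasz_gradient \<mu> \<Omega> \<Phi> Y u g \<longleftrightarrow> (\<forall>x\<in>\<Omega>. 0 \<le> g x) \<and> in_LPhi \<mu> \<Omega> \<Phi> g \<and>
     (\<exists>N \<in> null_sets \<mu>. \<forall>x \<in> \<Omega> - N. \<forall>x' \<in> \<Omega> - N.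
        mdist Y (u x) (u x') \<le> dist x x' * (g x + g x'))"

definition M1Phi :: "'x::metric_space measure \<Rightarrow> 'x set \<Rightarrow> (real \<Rightarrow> real) \<Rightarrow> 'y metric \<Rightarrow> ('x \<Rightarrow> 'y) set" where
  "M1Phi \<mu> \<Omega> \<Phi> Y = {u. in_LPhi_map \<mu> \<Omega> \<Phi> Y u \<and> (\<exists>g. hajlasz_gradient \<mu> \<Omega> \<Phi> Y u g)}"

definition E_H :: "'x::metric_space measure \<Rightarrow> 'x set \<Rightarrow> (real \<Rightarrow> real) \<Rightarrow> 'y metric \<Rightarrow> ('x \<Rightarrow> 'y) \<Rightarrow> ennreal" where
  "E_H \<mu> \<Omega> \<Phi> Y u = (INF g \<in> {g. hajlasz_gradient \<mu> \<Omega> \<Phi> Y u g}. lux_norm \<mu> \<Omega> \<Phi> g)"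

definition uniformly_compact :: "(nat \<Rightarrow> 'y metric) \<Rightarrow> (nat \<Rightarrow> 'y set) \<Rightarrow> bool" where
  "uniformly_compact Y K \<longleftrightarrow>
     (\<exists>D. \<forall>m. \<forall>a\<in>K m. \<forall>b\<in>K m. mdist (Y m) a b \<le> D) \<and>
     (\<forall>\<epsilon>>0. \<exists>N::nat. \<forall>m. \<exists>C. finite C \<and> card C \<le> N \<and> C \<subseteq> K m \<and>
         K m \<subseteq> (\<Union>c\<in>C. mball_of (Y m) c \<epsilon>))"

definition isometric_embedding :: "'y metric \<Rightarrow> 'z metric \<Rightarrow> ('y \<Rightarrow> 'z) \<Rightarrow> bool" where
  "isometric_embedding Y Z \<phi> \<longleftrightarrow> \<phi> ` mspace Y \<subseteq> mspace Z \<and>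
     (\<forall>a\<in>mspace Y. \<forall>b\<in>mspace Y. mdist Z (\<phi> a) (\<phi> b) = mdist Y a b)"

end

theory Submission
  imports Defs "HOL-Library.Diagonal_Subsequence"
begin

text \<open>
  Partition \<open>\<Omega>\<close>, which is totally bounded because \<open>\<mu>\<close> is doubling, into finitely many cells of diameter
  at most \<open>\<epsilon>\<close>. Replacing \<open>u\<^sub>m\<close> on each cell by its value at a point where the Hajlasz gradient and the
  distance to \<open>y\<^sub>m\<close> are at most average changes \<open>u\<^sub>m\<close> by \<open>O(\<epsilon>)\<close> in \<open>L\<^sup>\<Phi>\<close>, uniformly in \<open>m\<close>. For
  \<open>\<epsilon> = 2\<^sup>-\<^sup>j\<close> the values of these step maps, together with finite nets of the \<open>K\<^sub>m\<close>, form countably many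
  labelled points in each \<open>Y\<^sub>m\<close> with mutual distances bounded in \<open>m\<close>. Along a subsequence these distances
  converge, and the \<open>Y\<^sub>m\<close> can be glued inside a space of bounded functions so that each labelled point
  converges. The step maps then converge, hence so do the \<open>u\<^sub>m\<close>, and the closure of the union of the
  embedded \<open>K\<^sub>m\<close> is compact. A Hajlasz gradient of the limit arises as an almost everywhere limit of convex
  combinations of gradients of the \<open>u\<^sub>m\<close>.
\<close>

section \<open>Gluing metric spaces along converging distances\<close>

text \<open>Closed balls of the complete spaces \<open>Y m\<close> need not be compact, so no limit
  of the values can be extracted inside the targets. The target is built to fit instead: labelled
  points converge as soon as their mutual distances do, and countably many bounded sequences of
  numbers converge along a common subsequence. This is why the labels must be countable, the cells
  the same for all \<open>m\<close>, and the distances from \<open>y m\<close> to the step values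
  bounded by a quantity that does not depend on \<open>m\<close>. Two more points shape the
  argument. The glued space need not be separable, so the distance between two Borel maps into it
  need not be measurable; measurability of distances is therefore derived through countably valued
  maps. And the limit gradient is found without weak compactness: modular bounds give
  \<open>L^1\<close> bounds on \<open>\<Omega>\<close>, which has finite measure, these suffice for
  almost everywhere convergence of convex combinations, and Fatou's lemma returns the modular
  bound.\<close>

lemma bounded_funspace_iff:
  "f \<in> mspace (funspace S euclidean_metric) \<longleftrightarrow>
     f \<in> extensional S \<and> (\<exists>B. \<forall>x\<in>S. \<bar>f x\<bar> \<le> (B::real))"
proof -
  have "Met_TC.mbounded (f ` S) \<longleftrightarrow> (\<exists>B. \<forall>x\<in>S. \<bar>f x\<bar> \<le> B)"
    using bounded_iff[of "f ` S"] by (simp add: mbounded_iff_bounded)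
  then show ?thesis
    by (simp add: Met_TC.fspace_def)
qed

lemma mdist_funspace_le:
  fixes f g :: "'a \<Rightarrow> real"
  assumes "f \<in> mspace (funspace S euclidean_metric)" "g \<in> mspace (funspace S euclidean_metric)"
    and "S \<noteq> {}" "\<And>x. x \<in> S \<Longrightarrow> \<bar>f x - g x\<bar> \<le> a"
  shows "mdist (funspace S euclidean_metric) f g \<le> a"
  using assms funspace_mdist_le[of f S euclidean_metric g a] by (simp add: dist_real_def)

lemma abs_diff_le_mdist_funspace:
  fixes f g :: "'a \<Rightarrow> real"
  assumes "f \<in> mspace (funspace S euclidean_metric)" "g \<in> mspace (funspace S euclidean_metric)"
    and "x \<in> S"
  shows "\<bar>f x - g x\<bar> \<le> mdist (funspace S euclidean_metric) f g"
  using assms funspace_mdist_le[of f S euclidean_metric g "mdist (funspace S euclidean_metric) f g"]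
  by (auto simp add: dist_real_def)

lemma mcomplete_bounded_funspace: "mcomplete_of (funspace S (euclidean_metric :: real metric))"
proof -
  have "Met_TC.mcomplete (TYPE(real))"
    by (simp add: mcomplete_iff_complete complete_UNIV)
  then have "mcomplete_of (funspace S (Met_TC.Self :: real metric))"
    by (rule Met_TC.mcomplete_funspace)
  then show ?thesis
    by (simp add: euclidean_metric_def Met_TC.Self_def)
qed

text \<open>A segment of length \<open>\<eta> m a\<close> at \<open>p m a\<close> creates no
  shortcut as long as the distances in \<open>Y m\<close> and in the limit differ by at most
  \<open>\<eta> m a + \<eta> m b\<close>. Hence each \<open>Y m\<close> keeps its metric, while the
  shrinking segments pull \<open>p m a\<close> to its limit. \<open>D\<close> may vanish off the
  diagonal, so \<open>\<psi>\<close> need not be injective.\<close>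

lemma metric_gluing:
  fixes Y :: "nat \<Rightarrow> 'y metric" and p :: "nat \<Rightarrow> nat \<Rightarrow> 'y" and D :: "nat \<Rightarrow> nat \<Rightarrow> real"
  assumes p: "\<And>m a. p m a \<in> mspace (Y m)"
    and D: "\<And>a b. (\<lambda>m. mdist (Y m) (p m a) (p m b)) \<longlonglongrightarrow> D a b"
  shows "\<exists>(Z :: (nat \<times> 'y \<Rightarrow> real) metric) \<phi> \<psi>. mcomplete_of Z \<and>
     (\<forall>m. isometric_embedding (Y m) Z (\<phi> m)) \<and> (\<forall>a. \<psi> a \<in> mspace Z) \<and>
     (\<forall>a. (\<lambda>m. mdist Z (\<phi> m (p m a)) (\<psi> a)) \<longlonglongrightarrow> 0)"
proof -
  define d where "d m = mdist (Y m)" for m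
  have d_nn: "0 \<le> d m x y" and d_sym: "d m x y = d m y x" for m x y
    by (simp_all add: d_def mdist_commute)
  have d_self: "d m x x = 0" if "x \<in> mspace (Y m)" for m x
    using that by (simp add: d_def)
  have d_tri: "d m x z \<le> d m x y + d m y z" if "x \<in> mspace (Y m)" "y \<in> mspace (Y m)" "z \<in> mspace (Y m)" for m x y z
    using that by (simp add: d_def mdist_triangle)
  have D': "(\<lambda>m. d m (p m a) (p m b)) \<longlonglongrightarrow> D a b" for a b
    using D by (simp add: d_def)
  have D_nn: "0 \<le> D a b" for a b
    by (rule LIMSEQ_le_const[OF D']) (auto simp: d_nn)
  have D_sym: "D a b = D b a" for a b
    using LIMSEQ_unique[OF D'[of a b]] D'[of b a] by (simp add: d_sym)
  have D_self: "D a a = 0" for a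
    using LIMSEQ_unique[OF D'[of a a]] by (simp add: d_self p)
  have D_tri: "D a c \<le> D a b + D b c" for a b c
    by (rule LIMSEQ_le[OF D'[of a c] tendsto_add[OF D'[of a b] D'[of b c]]]) (auto intro: d_tri p)
  \<comment> \<open>The errors at \<open>a\<close> and \<open>b\<close> together have to control
    every pair, yet only a finite sum is sure to vanish as \<open>m\<close> grows. Summing over
    \<open>b \<le> a\<close> achieves both: the larger index accounts for the pair.\<close>
  define \<eta> where "\<eta> m a = (\<Sum>b\<le>a. \<bar>d m (p m a) (p m b) - D a b\<bar>)" for m a
  have \<eta>_nn: "0 \<le> \<eta> m a" for m a
    by (simp add: \<eta>_def sum_nonneg)
  have \<eta>1: "\<bar>d m (p m a) (p m b) - D a b\<bar> \<le> \<eta> m a" if "b \<le> a" for m a b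
    unfolding \<eta>_def by (rule member_le_sum) (use that in auto)
  have \<eta>: "\<bar>d m (p m a) (p m b) - D a b\<bar> \<le> \<eta> m a + \<eta> m b" for m a b
    using \<eta>1[of b a m] \<eta>1[of a b m] \<eta>_nn[of m a] \<eta>_nn[of m b] d_sym[of m "p m a" "p m b"] D_sym[of a b]
    by (cases "b \<le> a") auto
  have \<eta>_lim: "(\<lambda>m. \<eta> m a) \<longlonglongrightarrow> 0" for a
  proof -
    have "(\<lambda>m. \<eta> m a) \<longlonglongrightarrow> (\<Sum>b\<le>a. \<bar>D a b - D a b\<bar>)"
      unfolding \<eta>_def by (intro tendsto_intros D')
    then show ?thesis by simp
  qed
  \<comment> \<open>\<open>h m y l\<close> is the distance from \<open>y\<close> in \<open>Y m\<close> to the point \<open>l\<close> of the limit space \<open>(\<nat>, D)\<close>,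
     to which \<open>p m a\<close> is joined by a segment of length \<open>\<eta> m a\<close> ending at \<open>a\<close>.\<close>
  define h where "h m y l = (INF a. d m y (p m a) + \<eta> m a + D a l)" for m y l
  have bdd: "bdd_below (range (\<lambda>a. d m y (p m a) + \<eta> m a + D a l))" for m y l
    by (rule bdd_belowI[of _ 0]) (auto intro!: add_nonneg_nonneg d_nn \<eta>_nn D_nn)
  have h_le: "h m y l \<le> d m y (p m a) + \<eta> m a + D a l" for m y l a
    unfolding h_def by (rule cINF_lower[OF bdd]) simp
  have h_ge: "c \<le> h m y l" if "\<And>a. c \<le> d m y (p m a) + \<eta> m a + D a l" for c m y l
    unfolding h_def by (rule cINF_greatest) (use that in auto)
  have h_nn: "0 \<le> h m y l" for m y l
    by (rule h_ge) (auto intro!: add_nonneg_nonneg d_nn \<eta>_nn D_nn)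
  have h_lip2: "h m y l \<le> h m y l' + D l l'" for m y l l'
  proof -
    have "h m y l - D l l' \<le> h m y l'"
    proof (rule h_ge)
      fix a show "h m y l - D l l' \<le> d m y (p m a) + \<eta> m a + D a l'"
        using h_le[of m y l a] D_tri[of a l l'] D_sym[of l l'] by linarith
    qed
    then show ?thesis by simp
  qed
  have h_lip1: "h m y l \<le> h m y' l + d m y y'" if "y \<in> mspace (Y m)" "y' \<in> mspace (Y m)" for m y y' l
  proof -
    have "h m y l - d m y y' \<le> h m y' l"
    proof (rule h_ge)
      fix a show "h m y l - d m y y' \<le> d m y' (p m a) + \<eta> m a + D a l"
        using h_le[of m y l a] d_tri[OF that p, of a] by linarith
    qed
    then show ?thesis by simp
  qed
  have h_D: "D l l' \<le> h m y l + h m y l'" if "y \<in> mspace (Y m)" for m y l l'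
  proof -
    have "D l l' - h m y l' \<le> h m y l"
    proof (rule h_ge)
      fix a
      have "D l l' - (d m y (p m a) + \<eta> m a + D a l) \<le> h m y l'"
      proof (rule h_ge)
        fix b
        show "D l l' - (d m y (p m a) + \<eta> m a + D a l) \<le> d m y (p m b) + \<eta> m b + D b l'"
          using D_tri[of l l' a] D_tri[of a l' b] D_sym[of a l] \<eta>[of m a b]
            d_tri[OF p that p, of a b] d_sym[of m y "p m a"] by linarith
      qed
      then show "D l l' - h m y l' \<le> d m y (p m a) + \<eta> m a + D a l" by linarith
    qed
    then show ?thesis by simp
  qed
  have h_d: "d m y y' \<le> h m y l + h m y' l" if "y \<in> mspace (Y m)" "y' \<in> mspace (Y m)" for m y y' l
  proof -
    have "d m y y' - h m y' l \<le> h m y l"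
    proof (rule h_ge)
      fix a
      have "d m y y' - (d m y (p m a) + \<eta> m a + D a l) \<le> h m y' l"
      proof (rule h_ge)
        fix b
        show "d m y y' - (d m y (p m a) + \<eta> m a + D a l) \<le> d m y' (p m b) + \<eta> m b + D b l"
          using d_tri[OF that(1) p that(2), of a] d_tri[OF p p that(2), of a b] \<eta>[of m a b]
            D_tri[of a b l] D_sym[of b l] d_sym[of m y' "p m b"] by linarith
      qed
      then show "d m y y' - h m y' l \<le> d m y (p m a) + \<eta> m a + D a l" by linarith
    qed
    then show ?thesis by simp
  qed
  \<comment> \<open>The distance on the disjoint union of all \<open>Y m\<close>, where different
    spaces are connected only through the limit space. Of the triangle inequality, the cases
    \<open>\<rho>_lip\<close> and \<open>\<rho>_h\<close> suffice for the embedding.\<close>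
  define \<rho> where "\<rho> m z n y = (if n = m then d m z y else (INF l. h m z l + h n y l))" for m z n y
  have bdd2: "bdd_below (range (\<lambda>l. h m z l + h n y l))" for m z n y
    by (rule bdd_belowI[of _ 0]) (auto intro!: add_nonneg_nonneg h_nn)
  have \<rho>_le: "\<rho> m z n y \<le> h m z l + h n y l" if "n \<noteq> m" for m z n y l
    using that unfolding \<rho>_def by (auto intro: cINF_lower[OF bdd2])
  have \<rho>_ge: "c \<le> \<rho> m z n y" if "n \<noteq> m" "\<And>l. c \<le> h m z l + h n y l" for c m z n y
    using that unfolding \<rho>_def by (auto intro!: cINF_greatest)
  have \<rho>_lip: "\<rho> m z n y \<le> \<rho> m z' n y + d m z z'"
    if "z \<in> mspace (Y m)" "z' \<in> mspace (Y m)" "y \<in> mspace (Y n)" for m z z' n y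
  proof (cases "n = m")
    case True
    then show ?thesis using d_tri[of z m z' y] that by (simp add: \<rho>_def)
  next
    case False
    have "\<rho> m z n y - d m z z' \<le> \<rho> m z' n y"
    proof (rule \<rho>_ge[OF False])
      fix l show "\<rho> m z n y - d m z z' \<le> h m z' l + h n y l"
        using \<rho>_le[OF False, of z y l] h_lip1[OF that(1,2), of l] by linarith
    qed
    then show ?thesis by simp
  qed
  have \<rho>_h: "\<bar>\<rho> m z n y - h n y l\<bar> \<le> h m z l" if "z \<in> mspace (Y m)" "y \<in> mspace (Y n)" for m z n y l
  proof (cases "n = m")
    case True
    then show ?thesis
      using h_d[of z m y l] h_lip1[of y m z l] that d_sym[of m y z] by (simp add: \<rho>_def)
  next
    case False
    have "h n y l - h m z l \<le> \<rho> m z n y"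
    proof (rule \<rho>_ge[OF False])
      fix l' show "h n y l - h m z l \<le> h m z l' + h n y l'"
        using h_D[OF that(1), of l l'] h_lip2[of n y l l'] by linarith
    qed
    then show ?thesis using \<rho>_le[OF False, of z y l] by linarith
  qed
  define S where "S = (SIGMA m:UNIV. mspace (Y m))"
  define Z where "Z = funspace S (euclidean_metric :: real metric)"
  have S_ne: "S \<noteq> {}" using p[of 0 0] by (auto simp: S_def)
  \<comment> \<open>Kuratowski embedding. Subtracting the distance \<open>h n y 0\<close> to the
    limit point 0 makes the functions bounded even if the spaces are not: \<open>\<phi> m z\<close>
    is bounded by \<open>h m z 0\<close>.\<close>
  define \<phi> where "\<phi> m z = restrict (\<lambda>(n,y). \<rho> m z n y - h n y 0) S" for m z
  define \<psi> where "\<psi> l = restrict (\<lambda>(n,y). h n y l - h n y 0) S" for l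
  have \<phi>_in: "\<phi> m z \<in> mspace Z" if "z \<in> mspace (Y m)" for m z
    unfolding Z_def bounded_funspace_iff
    using \<rho>_h[OF that, of _ _ 0] by (auto simp: \<phi>_def S_def)
  have \<psi>_in: "\<psi> l \<in> mspace Z" for l
    unfolding Z_def bounded_funspace_iff
  proof (intro conjI exI ballI)
    fix x assume x: "x \<in> S"
    obtain n y where "x = (n, y)" by fastforce
    then show "\<bar>\<psi> l x\<bar> \<le> D l 0"
      using h_lip2[of n y l 0] h_lip2[of n y 0 l] D_sym[of l 0] x
      by (simp add: \<psi>_def abs_le_iff)
  qed (simp add: \<psi>_def)
  have iso: "mdist Z (\<phi> m z) (\<phi> m z') = d m z z'" if "z \<in> mspace (Y m)" "z' \<in> mspace (Y m)" for m z z'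
  proof (rule antisym)
    show "mdist Z (\<phi> m z) (\<phi> m z') \<le> d m z z'"
      unfolding Z_def
    proof (rule mdist_funspace_le[OF \<phi>_in[unfolded Z_def] \<phi>_in[unfolded Z_def] S_ne])
      fix x assume "x \<in> S"
      then obtain n y where x: "x = (n,y)" "y \<in> mspace (Y n)" by (auto simp: S_def)
      show "\<bar>\<phi> m z x - \<phi> m z' x\<bar> \<le> d m z z'"
        using \<rho>_lip[OF that x(2)] \<rho>_lip[OF that(2,1) x(2)] d_sym[of m z z'] \<open>x \<in> S\<close>
        by (simp add: \<phi>_def x(1) abs_le_iff)
    qed (use that in auto)
    \<comment> \<open>The full distance is seen at the point \<open>z'\<close> itself, where the
      second function has \<open>\<rho> m z' m z' = 0\<close>.\<close>
    have "(m, z') \<in> S" using that by (simp add: S_def)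
    then have "\<bar>\<phi> m z (m,z') - \<phi> m z' (m,z')\<bar> \<le> mdist Z (\<phi> m z) (\<phi> m z')"
      unfolding Z_def using \<phi>_in[unfolded Z_def] that by (intro abs_diff_le_mdist_funspace) auto
    then show "d m z z' \<le> mdist Z (\<phi> m z) (\<phi> m z')"
      using \<open>(m, z') \<in> S\<close> that d_self by (simp add: \<phi>_def \<rho>_def)
  qed
  have near: "mdist Z (\<phi> m z) (\<psi> l) \<le> h m z l" if "z \<in> mspace (Y m)" for m z l
    unfolding Z_def
  proof (rule mdist_funspace_le[OF \<phi>_in[unfolded Z_def] \<psi>_in[unfolded Z_def] S_ne])
    fix x assume "x \<in> S"
    then obtain n y where x: "x = (n,y)" "y \<in> mspace (Y n)" by (auto simp: S_def)
    show "\<bar>\<phi> m z x - \<psi> l x\<bar> \<le> h m z l"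
      using \<rho>_h[OF that x(2)] \<open>x \<in> S\<close> by (simp add: \<phi>_def \<psi>_def x(1))
  qed (use that in auto)
  have "(\<lambda>m. mdist Z (\<phi> m (p m a)) (\<psi> a)) \<longlonglongrightarrow> 0" for a
  proof (rule tendsto_sandwich[OF _ _ tendsto_const \<eta>_lim])
    show "\<forall>\<^sub>F m in sequentially. mdist Z (\<phi> m (p m a)) (\<psi> a) \<le> \<eta> m a"
    proof (rule always_eventually, rule allI)
      fix m
      have "mdist Z (\<phi> m (p m a)) (\<psi> a) \<le> h m (p m a) a" by (rule near[OF p])
      also have "\<dots> \<le> \<eta> m a" using h_le[of m "p m a" a a] by (simp add: d_self[OF p] D_self)
      finally show "mdist Z (\<phi> m (p m a)) (\<psi> a) \<le> \<eta> m a" .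
    qed
  qed auto
  moreover have "isometric_embedding (Y m) Z (\<phi> m)" for m
    unfolding isometric_embedding_def using iso \<phi>_in by (simp add: image_subset_iff d_def)
  moreover have "mcomplete_of Z"
    unfolding Z_def by (rule mcomplete_bounded_funspace)
  ultimately show ?thesis
    using \<psi>_in by (intro exI[of _ Z] exI[of _ \<phi>] exI[of _ \<psi>]) simp
qed

lemma bounded_family_convergent_subseq:
  fixes f :: "nat \<Rightarrow> 'l::countable \<Rightarrow> real"
  assumes bdd: "\<And>l. \<exists>B. \<forall>m. \<bar>f m l\<bar> \<le> B"
  obtains \<sigma> :: "nat \<Rightarrow> nat" where "strict_mono \<sigma>" "\<And>l. convergent (\<lambda>k. f (\<sigma> k) l)"
proof -
  interpret subseqs "\<lambda>n s. convergent (\<lambda>k. f (s k) (from_nat n))"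
  proof
    fix n and s :: "nat \<Rightarrow> nat"
    obtain B where "\<And>m. \<bar>f m (from_nat n)\<bar> \<le> B" using bdd by blast
    then have "bounded (range (\<lambda>k. f (s k) (from_nat n)))"
      by (auto simp: bounded_iff)
    then show "\<exists>r'. strict_mono r' \<and> convergent (\<lambda>k. f ((s \<circ> r') k) (from_nat n))"
      using bounded_imp_convergent_subsequence by (fastforce simp: o_def convergent_def)
  qed
  \<comment> \<open>The diagonal sequence refines the \<open>n\<close>-th chosen subsequence only
    after a shift by \<open>Suc n\<close>; the shift is removed below, since convergence depends on
    the tail alone.\<close>
  have "convergent (\<lambda>k. f ((diagseq \<circ> (+) (Suc n)) k) (from_nat n))" for n
    by (rule diagseq_holds) (auto simp: o_def dest: convergent_subseq_convergent)
  moreover have "diagseq \<circ> (+) (Suc n) = (\<lambda>k. diagseq (k + Suc n))" for n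
    by (simp add: fun_eq_iff add.commute)
  ultimately have "convergent (\<lambda>k. f (diagseq (k + Suc n)) (from_nat n))" for n
    by metis
  then have conv: "convergent (\<lambda>k. f (diagseq k) (from_nat n))" for n
    using convergent_ignore_initial_segment[of "\<lambda>k. f (diagseq k) (from_nat n)" "Suc n"] by simp
  have "convergent (\<lambda>k. f (diagseq k) l)" for l
    using conv[of "to_nat l"] by simp
  then show ?thesis by (rule that[OF subseq_diagseq])
qed

lemma gluing_subsequence:
  fixes Y :: "nat \<Rightarrow> 'y metric" and p :: "nat \<Rightarrow> 'l::countable \<Rightarrow> 'y"
  assumes p: "\<And>m a. p m a \<in> mspace (Y m)"
    and bdd: "\<And>a b. \<exists>B. \<forall>m. mdist (Y m) (p m a) (p m b) \<le> B"
  shows "\<exists>(\<sigma> :: nat \<Rightarrow> nat) (Z :: (nat \<times> 'y \<Rightarrow> real) metric) \<phi> \<psi>. strict_mono \<sigma> \<and> mcomplete_of Z \<and>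
     (\<forall>k. isometric_embedding (Y (\<sigma> k)) Z (\<phi> k)) \<and> (\<forall>a. \<psi> a \<in> mspace Z) \<and>
     (\<forall>a. (\<lambda>k. mdist Z (\<phi> k (p (\<sigma> k) a)) (\<psi> a)) \<longlonglongrightarrow> 0)"
proof -
  obtain \<sigma> :: "nat \<Rightarrow> nat" where \<sigma>: "strict_mono \<sigma>"
    and conv: "\<And>ab. convergent (\<lambda>k. (\<lambda>(a,b). mdist (Y (\<sigma> k)) (p (\<sigma> k) a) (p (\<sigma> k) b)) ab)"
  proof (rule bounded_family_convergent_subseq[of "\<lambda>m (a,b). mdist (Y m) (p m a) (p m b)"])
    show "\<exists>B. \<forall>m. \<bar>case ab of (a, b) \<Rightarrow> mdist (Y m) (p m a) (p m b)\<bar> \<le> B" for ab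
      using bdd by (cases ab) auto
  qed (use that in blast)
  define q :: "nat \<Rightarrow> nat \<Rightarrow> 'y" where "q k n = p (\<sigma> k) (from_nat n)" for k n
  have q: "q k n \<in> mspace (Y (\<sigma> k))" for k n
    by (simp add: q_def p)
  have lim_q: "(\<lambda>k. mdist (Y (\<sigma> k)) (q k a) (q k b)) \<longlonglongrightarrow> lim (\<lambda>k. mdist (Y (\<sigma> k)) (q k a) (q k b))" for a b
    using conv[of "(from_nat a, from_nat b)"] by (simp add: q_def convergent_LIMSEQ_iff)
  obtain Z :: "(nat \<times> 'y \<Rightarrow> real) metric" and \<phi> \<psi> where
    Z: "mcomplete_of Z" "\<forall>k. isometric_embedding (Y (\<sigma> k)) Z (\<phi> k)" "\<forall>a. \<psi> a \<in> mspace Z"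
    and lim_Z: "\<forall>a. (\<lambda>k. mdist Z (\<phi> k (q k a)) (\<psi> a)) \<longlonglongrightarrow> 0"
    using metric_gluing[of q "\<lambda>k. Y (\<sigma> k)", OF q lim_q] by blast
  have "(\<lambda>k. mdist Z (\<phi> k (p (\<sigma> k) a)) (\<psi> (to_nat a))) \<longlonglongrightarrow> 0" for a
    using lim_Z[rule_format, of "to_nat a"] by (simp add: q_def)
  then show ?thesis
    using \<sigma> Z by (intro exI[of _ \<sigma>] exI[of _ Z] exI[of _ \<phi>] exI[of _ "\<lambda>a. \<psi> (to_nat a)"]) simp
qed

section \<open>Modulars of N-functions\<close>

lemma N_function_scale:
  assumes "N_function \<Phi>" "0 \<le> t" "t \<le> 1"
  shows "\<Phi> (t * x) \<le> t * \<Phi> x"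
proof -
  have "convex_on UNIV \<Phi>" "\<Phi> 0 = 0"
    using assms(1) by (auto simp: N_function_def)
  then show ?thesis
    using convex_onD[of UNIV \<Phi> t 0 x] assms(2,3) by simp
qed

lemma N_function_mono:
  assumes "N_function \<Phi>" "0 \<le> a" "a \<le> b"
  shows "\<Phi> a \<le> \<Phi> b"
proof (cases "b = 0")
  case False
  then have "\<Phi> (a / b * b) \<le> a / b * \<Phi> b"
    using assms by (intro N_function_scale) auto
  also have "\<dots> \<le> 1 * \<Phi> b"
    using assms False by (intro mult_right_mono) (auto simp: N_function_def)
  finally show ?thesis using False by simp
qed (use assms in auto)

lemma N_function_pos: "N_function \<Phi> \<Longrightarrow> x \<noteq> 0 \<Longrightarrow> 0 < \<Phi> x"
  unfolding N_function_def by (metis less_eq_real_def)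

lemma N_function_nonneg: "N_function \<Phi> \<Longrightarrow> 0 \<le> \<Phi> x"
  by (simp add: N_function_def)

text \<open>For \<open>1 \<le> t\<close>, convexity and \<open>\<Phi> 0 = 0\<close> make
  \<open>\<Phi> t / t\<close> at least \<open>\<Phi> 1\<close>. On a space of finite measure this
  turns modular bounds into \<open>L^1\<close> bounds.\<close>

lemma N_function_linear_bound:
  assumes N: "N_function \<Phi>" and t: "0 \<le> t"
  shows "t \<le> 1 + \<Phi> t / \<Phi> 1"
proof (cases "t \<le> 1")
  case True
  then show ?thesis
    using N_function_nonneg[OF N, of t] N_function_pos[OF N, of 1] by (smt (verit) divide_nonneg_pos)
next
  case False
  have "\<Phi> (1/t * t) \<le> 1/t * \<Phi> t"
    using False by (intro N_function_scale[OF N]) auto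
  then have "t \<le> \<Phi> t / \<Phi> 1"
    using False N_function_pos[OF N, of 1] by (simp add: field_simps)
  then show ?thesis by simp
qed

text \<open>The argument on the left is the convex combination of \<open>a / k\<close> and
  \<open>b / l\<close> with weights proportional to \<open>k\<close> and \<open>l\<close>; this is
  the source of the triangle inequality for the Luxemburg norm.\<close>

lemma N_function_weighted:
  assumes N: "N_function \<Phi>" and "0 < k" "0 < l"
  shows "\<Phi> ((a + b) / (k + l)) \<le> k / (k + l) * \<Phi> (a / k) + l / (k + l) * \<Phi> (b / l)"
proof -
  have "convex_on UNIV \<Phi>" using N by (simp add: N_function_def)
  then have "\<Phi> ((1 - l / (k+l)) * (a/k) + l / (k+l) * (b/l))
      \<le> (1 - l / (k+l)) * \<Phi> (a/k) + l / (k+l) * \<Phi> (b/l)"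
    using convex_onD[of UNIV \<Phi> "l/(k+l)" "a/k" "b/l"] assms by simp
  moreover have "1 - l / (k+l) = k / (k+l)" using assms by (simp add: field_simps)
  moreover have "k/(k+l) * (a/k) + l / (k+l) * (b/l) = (a+b)/(k+l)"
    using assms by (simp add: add_divide_distrib)
  ultimately show ?thesis by simp
qed

lemma N_function_measurable:
  assumes "N_function \<Phi>" shows "\<Phi> \<in> borel_measurable borel"
  using assms by (intro borel_measurable_continuous_onI) (simp add: N_function_def)

text \<open>The condition \<open>modular M \<Phi> f k \<le> 1\<close> stands in for a Luxemburg norm
  of at most \<open>k\<close>. It avoids the infimum, survives Fatou's lemma, and its radii add up
  under sums of functions.\<close>

definition modular :: "'x measure \<Rightarrow> (real \<Rightarrow> real) \<Rightarrow> ('x \<Rightarrow> real) \<Rightarrow> real \<Rightarrow> ennreal" where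
  "modular M \<Phi> f k = (\<integral>\<^sup>+x. ennreal (\<Phi> (\<bar>f x\<bar> / k)) \<partial>M)"

lemma lux_norm_modular:
  assumes "\<Omega> \<in> sets \<mu>"
  shows "lux_norm \<mu> \<Omega> \<Phi> f = (INF k \<in> {k. k > 0 \<and> modular (restrict_space \<mu> \<Omega>) \<Phi> f k \<le> 1}. ennreal k)"
  unfolding lux_norm_def modular_def using assms by (simp add: nn_integral_restrict_space)

lemma lux_norm_le:
  assumes "\<Omega> \<in> sets \<mu>" "0 < k" "modular (restrict_space \<mu> \<Omega>) \<Phi> f k \<le> 1"
  shows "lux_norm \<mu> \<Omega> \<Phi> f \<le> ennreal k"
  unfolding lux_norm_modular[OF assms(1)] using assms(2,3) by (auto intro: INF_lower)

lemma modular_mono: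
  assumes N: "N_function \<Phi>" and "0 < k" "k \<le> l" "AE x in M. \<bar>f x\<bar> \<le> \<bar>g x\<bar>"
  shows "modular M \<Phi> f l \<le> modular M \<Phi> g k"
  unfolding modular_def
proof (rule nn_integral_mono_AE)
  show "AE x in M. ennreal (\<Phi> (\<bar>f x\<bar> / l)) \<le> ennreal (\<Phi> (\<bar>g x\<bar> / k))"
    using assms(4)
  proof eventually_elim
    case (elim x)
    have "\<bar>f x\<bar> / l \<le> \<bar>g x\<bar> / k" using elim assms(2,3) by (intro frac_le) auto
    then show ?case using N_function_mono[OF N] assms(2,3) by (intro ennreal_leI) auto
  qed
qed

lemma modular_le_one_mono:
  assumes "N_function \<Phi>" "modular M \<Phi> f k \<le> 1" "0 < k" "k \<le> l"
  shows "modular M \<Phi> f l \<le> 1"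
  using modular_mono[OF assms(1,3,4), of f f M] assms(2) by auto

lemma modular_le_one_of_lux_norm:
  assumes N: "N_function \<Phi>" and \<Omega>: "\<Omega> \<in> sets \<mu>" and "lux_norm \<mu> \<Omega> \<Phi> f < ennreal k"
  shows "modular (restrict_space \<mu> \<Omega>) \<Phi> f k \<le> 1"
proof -
  obtain l where "0 < l" "modular (restrict_space \<mu> \<Omega>) \<Phi> f l \<le> 1" "ennreal l < ennreal k"
    using assms(3) unfolding lux_norm_modular[OF \<Omega>] by (auto simp: INF_less_iff)
  then show ?thesis
    using modular_mono[OF N, of l k f f "restrict_space \<mu> \<Omega>"] by (auto simp: ennreal_less_iff)
qed

text \<open>Convexity with \<open>\<Phi> 0 = 0\<close> trades a factor 2 in the radius for a factor
  1/2 in the modular. Two functions treated this way have modulars of sum at most 1, as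
  \<open>step_approximation\<close> requires.\<close>

lemma modular_half:
  assumes N: "N_function \<Phi>" and f: "f \<in> borel_measurable M" and "modular M \<Phi> f k \<le> 1"
  shows "modular M \<Phi> f (2 * k) \<le> ennreal (1/2)"
proof -
  note [measurable] = N_function_measurable[OF N] f
  have "modular M \<Phi> f (2 * k) \<le> (\<integral>\<^sup>+x. ennreal (1/2) * ennreal (\<Phi> (\<bar>f x\<bar> / k)) \<partial>M)"
    unfolding modular_def
  proof (rule nn_integral_mono)
    fix x
    have "\<Phi> (1/2 * (\<bar>f x\<bar> / k)) \<le> 1/2 * \<Phi> (\<bar>f x\<bar> / k)"
      by (rule N_function_scale[OF N]) auto
    then show "ennreal (\<Phi> (\<bar>f x\<bar> / (2 * k))) \<le> ennreal (1/2) * ennreal (\<Phi> (\<bar>f x\<bar> / k))"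
      by (subst ennreal_mult[symmetric]) (auto simp: N_function_nonneg[OF N] intro!: ennreal_leI)
  qed
  also have "\<dots> = ennreal (1/2) * modular M \<Phi> f k"
    unfolding modular_def by (rule nn_integral_cmult) measurable
  also have "\<dots> \<le> ennreal (1/2) * 1"
    using assms(3) by (rule mult_left_mono) simp
  finally show ?thesis by simp
qed

lemma modular_triangle:
  assumes N: "N_function \<Phi>" and f: "f \<in> borel_measurable M" and g: "g \<in> borel_measurable M"
    and kl: "0 < k" "0 < l" and le: "AE x in M. \<bar>s x\<bar> \<le> \<bar>f x\<bar> + \<bar>g x\<bar>"
    and f1: "modular M \<Phi> f k \<le> 1" and g1: "modular M \<Phi> g l \<le> 1"
  shows "modular M \<Phi> s (k + l) \<le> 1"
proof -
  note [measurable] = N_function_measurable[OF N] f g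
  define A B where "A = k / (k + l)" and "B = l / (k + l)"
  have AB: "0 \<le> A" "0 \<le> B" "A + B = 1"
    using kl by (auto simp: A_def B_def add_divide_distrib[symmetric])
  have "modular M \<Phi> s (k + l)
      \<le> (\<integral>\<^sup>+x. ennreal A * ennreal (\<Phi> (\<bar>f x\<bar> / k)) + ennreal B * ennreal (\<Phi> (\<bar>g x\<bar> / l)) \<partial>M)"
    unfolding modular_def
  proof (rule nn_integral_mono_AE, use le in eventually_elim)
    case (elim x)
    have "\<Phi> (\<bar>s x\<bar> / (k + l)) \<le> \<Phi> ((\<bar>f x\<bar> + \<bar>g x\<bar>) / (k + l))"
      using elim kl by (intro N_function_mono[OF N] divide_right_mono) auto
    also have "\<dots> \<le> A * \<Phi> (\<bar>f x\<bar> / k) + B * \<Phi> (\<bar>g x\<bar> / l)"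
      unfolding A_def B_def by (rule N_function_weighted[OF N kl])
    finally show ?case
      using AB by (subst (1 2) ennreal_mult[symmetric])
        (auto simp: N_function_nonneg[OF N] ennreal_plus[symmetric] simp del: ennreal_plus intro!: ennreal_leI)
  qed
  also have "\<dots> = ennreal A * modular M \<Phi> f k + ennreal B * modular M \<Phi> g l"
    unfolding modular_def by (subst nn_integral_add) (auto simp: nn_integral_cmult)
  also have "\<dots> \<le> ennreal A * 1 + ennreal B * 1"
    using f1 g1 by (intro add_mono mult_left_mono) auto
  also have "\<dots> = 1" using AB by (simp add: ennreal_plus[symmetric] del: ennreal_plus)
  finally show ?thesis .
qed

lemma modular_Fatou:
  assumes N: "N_function \<Phi>" and f: "\<And>n. f n \<in> borel_measurable M" and "0 < k"
    and lim: "AE x in M. (\<lambda>n. f n x) \<longlonglongrightarrow> F x" and le: "\<forall>\<^sub>F n in sequentially. modular M \<Phi> (f n) k \<le> C"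
  shows "modular M \<Phi> F k \<le> C"
proof -
  note [measurable] = N_function_measurable[OF N] f
  have cont: "isCont \<Phi> t" for t
    using N by (auto simp: N_function_def continuous_on_eq_continuous_at)
  have "modular M \<Phi> F k \<le> (\<integral>\<^sup>+x. liminf (\<lambda>n. ennreal (\<Phi> (\<bar>f n x\<bar> / k))) \<partial>M)"
    unfolding modular_def
  proof (rule nn_integral_mono_AE, use lim in eventually_elim)
    case (elim x)
    have "(\<lambda>n. ennreal (\<Phi> (\<bar>f n x\<bar> / k))) \<longlonglongrightarrow> ennreal (\<Phi> (\<bar>F x\<bar> / k))"
      using \<open>0 < k\<close> by (intro tendsto_ennrealI isCont_tendsto_compose[OF cont] tendsto_intros elim) auto
    then show ?case by (simp add: lim_imp_Liminf)
  qed
  also have "\<dots> \<le> liminf (\<lambda>n. modular M \<Phi> (f n) k)"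
    unfolding modular_def by (rule nn_integral_liminf) measurable
  also have "\<dots> \<le> C"
    using le by (intro Liminf_le) auto
  finally show ?thesis .
qed

lemma nn_integral_le_of_modular:
  assumes N: "N_function \<Phi>" and f: "f \<in> borel_measurable M" and k: "0 < k" and le: "modular M \<Phi> f k \<le> 1"
  shows "(\<integral>\<^sup>+x. ennreal \<bar>f x\<bar> \<partial>M) \<le> ennreal k * (emeasure M (space M) + ennreal (1 / \<Phi> 1))"
proof -
  note [measurable] = N_function_measurable[OF N] f
  have P: "0 < \<Phi> 1" by (rule N_function_pos[OF N]) simp
  have "(\<integral>\<^sup>+x. ennreal \<bar>f x\<bar> \<partial>M) \<le> (\<integral>\<^sup>+x. ennreal k * (1 + ennreal (1 / \<Phi> 1) * ennreal (\<Phi> (\<bar>f x\<bar> / k))) \<partial>M)"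
  proof (rule nn_integral_mono)
    fix x
    have "\<bar>f x\<bar> / k \<le> 1 + \<Phi> (\<bar>f x\<bar> / k) / \<Phi> 1"
      using k by (intro N_function_linear_bound[OF N]) auto
    then have "\<bar>f x\<bar> \<le> k * (1 + 1 / \<Phi> 1 * \<Phi> (\<bar>f x\<bar> / k))"
      using k by (simp add: field_simps)
    then have "ennreal \<bar>f x\<bar> \<le> ennreal (k * (1 + 1 / \<Phi> 1 * \<Phi> (\<bar>f x\<bar> / k)))"
      by (rule ennreal_leI)
    also have "\<dots> = ennreal k * (1 + ennreal (1 / \<Phi> 1) * ennreal (\<Phi> (\<bar>f x\<bar> / k)))"
      using k P N_function_nonneg[OF N] by (subst ennreal_mult, simp, simp, subst ennreal_plus, simp, simp, subst ennreal_mult) auto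
    finally show "ennreal \<bar>f x\<bar> \<le> \<dots>" .
  qed
  also have "\<dots> = ennreal k * (emeasure M (space M) + ennreal (1 / \<Phi> 1) * modular M \<Phi> f k)"
    unfolding modular_def
    by (subst nn_integral_cmult, measurable, subst nn_integral_add, measurable, subst nn_integral_cmult, measurable)
  also have "\<dots> \<le> ennreal k * (emeasure M (space M) + ennreal (1 / \<Phi> 1) * 1)"
    using le by (intro mult_left_mono add_left_mono) auto
  finally show ?thesis by simp
qed

lemma modular_bounded:
  assumes N: "N_function \<Phi>" and M: "finite_measure M" and "0 < k"
  obtains \<delta> where "0 < \<delta>"
    "\<And>f. (\<And>x. x \<in> space M \<Longrightarrow> \<bar>f x\<bar> \<le> \<delta>) \<Longrightarrow> modular M \<Phi> f k \<le> 1"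
proof -
  interpret finite_measure M by fact
  define m where "m = measure M (space M) + 1"
  have m: "1 \<le> m" by (simp add: m_def)
  have P: "0 < \<Phi> 1" by (rule N_function_pos[OF N]) simp
  \<comment> \<open>For \<open>t \<le> 1\<close> the bound
    \<open>\<Phi> t \<le> t * \<Phi> 1\<close> is available, and
    \<open>t \<le> 1 / (m * \<Phi> 1)\<close> brings it down to \<open>1 / m\<close>, whose integral
    is at most 1. The summand 1 in \<open>m\<close> keeps the quotient meaningful on a null
    space.\<close>
  define \<delta> where "\<delta> = k * min 1 (1 / (m * \<Phi> 1))"
  have "modular M \<Phi> f k \<le> 1" if f: "\<And>x. x \<in> space M \<Longrightarrow> \<bar>f x\<bar> \<le> \<delta>" for f
  proof -
    have "modular M \<Phi> f k \<le> (\<integral>\<^sup>+x. ennreal (1 / m) \<partial>M)"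
      unfolding modular_def
    proof (rule nn_integral_mono, rule ennreal_leI)
      fix x assume "x \<in> space M"
      then have "\<bar>f x\<bar> / k \<le> min 1 (1 / (m * \<Phi> 1))"
        using f[of x] \<open>0 < k\<close> unfolding \<delta>_def by (subst pos_divide_le_eq) (auto simp: mult.commute)
      then have "\<Phi> (\<bar>f x\<bar> / k) \<le> \<Phi> (min 1 (1 / (m * \<Phi> 1)) * 1)"
        using \<open>0 < k\<close> by (intro N_function_mono[OF N]) auto
      also have "\<dots> \<le> min 1 (1 / (m * \<Phi> 1)) * \<Phi> 1"
          using m P by (intro N_function_scale[OF N]) auto
      also have "\<dots> \<le> 1 / (m * \<Phi> 1) * \<Phi> 1"
        using P by (intro mult_right_mono) auto
      also have "\<dots> = 1 / m" using P by simp
      finally show "\<Phi> (\<bar>f x\<bar> / k) \<le> 1 / m" .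
    qed
    also have "\<dots> = ennreal (1 / m * measure M (space M))"
      using m by (subst ennreal_mult) (auto simp: emeasure_eq_measure)
    also have "\<dots> \<le> ennreal 1"
    proof (rule ennreal_leI)
      have "measure M (space M) \<le> m" by (simp add: m_def)
      then show "1 / m * measure M (space M) \<le> 1" using m by simp
    qed
    finally show ?thesis by simp
  qed
  moreover have "0 < \<delta>" using \<open>0 < k\<close> m P by (simp add: \<delta>_def)
  ultimately show ?thesis using that by blast
qed

section \<open>Almost everywhere limits of convex combinations\<close>

text \<open>All properties required of convex combinations are stable under midpoints, so dyadic
  weights suffice and the proofs go by rule induction. The index \<open>n\<close> restricts to the
  tail, because inequalities that hold only in the limit are available there alone.\<close>

inductive midpoint_hull :: "(nat \<Rightarrow> 'a \<Rightarrow> real) \<Rightarrow> nat \<Rightarrow> ('a \<Rightarrow> real) \<Rightarrow> bool" for g n where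
  base: "n \<le> i \<Longrightarrow> midpoint_hull g n (g i)"
| mid: "midpoint_hull g n a \<Longrightarrow> midpoint_hull g n b \<Longrightarrow> midpoint_hull g n (\<lambda>x. (a x + b x) / 2)"

lemma midpoint_hull_antimono:
  assumes "midpoint_hull g m a" "n \<le> m" shows "midpoint_hull g n a"
  using assms by induction (auto intro: midpoint_hull.intros)

lemma midpoint_hull_measurable:
  assumes "midpoint_hull g n a" "\<And>i. g i \<in> borel_measurable M" shows "a \<in> borel_measurable M"
  using assms by induction auto

lemma midpoint_hull_ge:
  assumes "midpoint_hull g n a" "\<And>i. n \<le> i \<Longrightarrow> c \<le> g i x" shows "c \<le> a x"
  using assms by induction auto

text \<open>With the left side frozen at a constant \<open>c\<close>, the Hajlasz inequality is
  affine in the gradient, so it survives convex combinations.\<close>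

lemma midpoint_hull_sum_ge:
  assumes "midpoint_hull g n a" "\<And>i. n \<le> i \<Longrightarrow> c \<le> t * (g i x + g i y)"
  shows "c \<le> t * (a x + a y)"
  using assms
proof induction
  case (mid a b)
  then have "c \<le> (t * (a x + a y) + t * (b x + b y)) / 2" by fastforce
  then show ?case by (simp add: algebra_simps add_divide_distrib)
qed auto

lemma midpoint_hull_modular:
  assumes "midpoint_hull g n a" and N: "N_function \<Phi>" and g: "\<And>i. g i \<in> borel_measurable M"
    and k: "0 < k" and le: "\<And>i. modular M \<Phi> (g i) k \<le> 1"
  shows "modular M \<Phi> a k \<le> 1"
  using assms(1)
proof induction
  case (mid a b)
  note meas = midpoint_hull_measurable[OF mid.hyps(1) g] midpoint_hull_measurable[OF mid.hyps(2) g]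
  have "modular M \<Phi> (\<lambda>x. a x + b x) (k + k) \<le> 1"
    by (rule modular_triangle[OF N meas k k _ mid.IH]) auto
  then show ?case by (simp add: modular_def mult_2[symmetric])
qed (use le in auto)

lemma midpoint_hull_nn_integral:
  assumes "midpoint_hull g n a" and g: "\<And>i. g i \<in> borel_measurable M"
    and nn: "\<And>i x. x \<in> space M \<Longrightarrow> 0 \<le> g i x"
    and le: "\<And>i. (\<integral>\<^sup>+x. ennreal (g i x) \<partial>M) \<le> B"
  shows "(\<integral>\<^sup>+x. ennreal (a x) \<partial>M) \<le> B"
  using assms(1)
proof induction
  case (mid a b)
  note [measurable] = midpoint_hull_measurable[OF mid.hyps(1) g] midpoint_hull_measurable[OF mid.hyps(2) g]
  have ge: "0 \<le> a x" "0 \<le> b x" if "x \<in> space M" for x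
    by (rule midpoint_hull_ge[OF mid.hyps(1) nn[OF that]], rule midpoint_hull_ge[OF mid.hyps(2) nn[OF that]])
  have "(\<integral>\<^sup>+x. ennreal ((a x + b x) / 2) \<partial>M) = (\<integral>\<^sup>+x. ennreal (1/2) * (ennreal (a x) + ennreal (b x)) \<partial>M)"
  proof (rule nn_integral_cong)
    fix x assume x: "x \<in> space M"
    have "ennreal (1/2) * (ennreal (a x) + ennreal (b x)) = ennreal (1/2 * (a x + b x))"
      using ge[OF x] by (subst ennreal_mult) auto
    then show "ennreal ((a x + b x) / 2) = ennreal (1/2) * (ennreal (a x) + ennreal (b x))" by simp
  qed
  also have "\<dots> = ennreal (1/2) * ((\<integral>\<^sup>+x. ennreal (a x) \<partial>M) + (\<integral>\<^sup>+x. ennreal (b x) \<partial>M))"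
    by (subst nn_integral_cmult, measurable, subst nn_integral_add, measurable)
  also have "\<dots> \<le> ennreal (1/2) * (B + B)"
    by (intro mult_left_mono add_mono mid.IH) auto
  also have "\<dots> = (ennreal (1/2) + ennreal (1/2)) * B"
    by (simp only: distrib_left distrib_right)
  also have "\<dots> = B"
    by (subst ennreal_plus[symmetric]) auto
  finally show ?case .
qed (use le in auto)

text \<open>Minimising \<open>\<integral> exp (-h)\<close> over the hulls of the tails makes the functions \<open>exp (-h\<^sub>n / 2)\<close> Cauchy in
  \<open>L\<^sup>2\<close>, since the parallelogram identity turns the convexity defect of \<open>exp\<close> into a square.\<close>

lemma AE_convergent_midpoint_hull:
  assumes fin: "finite_measure M" and g: "\<And>i. g i \<in> borel_measurable M"
    and nn: "\<And>i x. x \<in> space M \<Longrightarrow> 0 \<le> g i x"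
    and le: "\<And>i. (\<integral>\<^sup>+x. ennreal (g i x) \<partial>M) \<le> B" and B: "B < \<infinity>"
  shows "\<exists>H h. (\<forall>n. midpoint_hull g n (H n)) \<and> h \<in> borel_measurable M \<and>
     (\<forall>x. 0 \<le> h x) \<and> (AE x in M. (\<lambda>n. H n x) \<longlonglongrightarrow> h x)"
proof -
  interpret finite_measure M by fact
  define E :: "(_ \<Rightarrow> real) \<Rightarrow> real" where "E a = (\<integral>x. exp (- a x) \<partial>M)" for a
  define J where "J n = Inf (E ` Collect (midpoint_hull g n))" for n
  have meas: "a \<in> borel_measurable M" if "midpoint_hull g n a" for n a
    using midpoint_hull_measurable[OF that g] .
  have pos: "0 \<le> a x" if "midpoint_hull g n a" "x \<in> space M" for n a x
    by (rule midpoint_hull_ge[OF that(1) nn[OF that(2)]])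
  have int: "integrable M (\<lambda>x. exp (- a x))" if "midpoint_hull g n a" for n a
    using meas[OF that] pos[OF that]
    by (intro integrable_const_bound[where B=1]) auto
  have bdd: "bdd_below (E ` Collect (midpoint_hull g n))" for n
    by (rule bdd_belowI[of _ 0]) (auto simp: E_def)
  have J_le: "J n \<le> E a" if "midpoint_hull g n a" for n a
    unfolding J_def by (rule cINF_lower[OF bdd]) (use that in auto)
  have "\<exists>a. midpoint_hull g n a \<and> E a < J n + 1 / Suc n" for n
  proof -
    have "Inf (E ` Collect (midpoint_hull g n)) < J n + 1 / Suc n" by (simp add: J_def)
    then show ?thesis
      using cInf_lessD[of "E ` Collect (midpoint_hull g n)"] midpoint_hull.base[of n n g] by blast
  qed
  then obtain H where H: "\<And>n. midpoint_hull g n (H n)" and EH: "\<And>n. E (H n) < J n + 1 / Suc n"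
    by metis
  \<comment> \<open>The hulls shrink as \<open>n\<close> grows, so the infima increase; they stay
    below the measure of the space because \<open>exp (- a x) \<le> 1\<close>.\<close>
  have "incseq J"
  proof (rule incseq_SucI)
    fix n
    have "J n \<le> E a" if "midpoint_hull g (Suc n) a" for a
      using J_le midpoint_hull_antimono[OF that] by simp
    then show "J n \<le> J (Suc n)"
      unfolding J_def[of "Suc n"] using midpoint_hull.base[of "Suc n" "Suc n" g]
      by (intro cINF_greatest) auto
  qed
  moreover have "J n \<le> measure M (space M)" for n
  proof -
    have "E (H n) \<le> (\<integral>x. 1 \<partial>M)"
      unfolding E_def by (intro integral_mono int[OF H]) (auto simp: pos[OF H])
    then show ?thesis using J_le[OF H, of n] by simp
  qed
  ultimately obtain L where L: "J \<longlonglongrightarrow> L" "\<And>n. J n \<le> L"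
    using incseq_convergent by metis
  define s where "s n x = exp (- H n x / 2)" for n x
  have s_bd: "0 \<le> s n x" "s n x \<le> 1" if "x \<in> space M" for n x
    using pos[OF H that] by (auto simp: s_def)
  have [measurable]: "H n \<in> borel_measurable M" for n by (rule meas[OF H])
  have [measurable]: "s n \<in> borel_measurable M" for n unfolding s_def by measurable
  have int_s: "integrable M (s n)" for n
    using s_bd by (intro integrable_const_bound[where B=1]) auto
  \<comment> \<open>The midpoint of \<open>H i\<close> and \<open>H j\<close> is a competitor in the
    hull of index \<open>N\<close>, so its value of \<open>E\<close> is at least \<open>J N\<close>,
    whereas \<open>H i\<close> and \<open>H j\<close> are nearly optimal.\<close>
  have sq: "(\<integral>x. (s i x - s j x)\<^sup>2 \<partial>M) \<le> 2 * (L + 1 / Suc N - J N)" if "N \<le> i" "N \<le> j" for i j N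
  proof -
    have "midpoint_hull g N (\<lambda>x. (H i x + H j x) / 2)"
      by (intro midpoint_hull.mid midpoint_hull_antimono[OF H] that)
    note m = J_le[OF this] int[OF this]
    have "(s i x - s j x)\<^sup>2 = exp (- H i x) + exp (- H j x) - 2 * exp (- ((H i x + H j x) / 2))" for x
    proof -
      have "(s k x)\<^sup>2 = exp (- H k x)" for k
        by (simp add: s_def power2_eq_square exp_add[symmetric])
      moreover have "s i x * s j x = exp (- ((H i x + H j x) / 2))"
        unfolding s_def exp_add[symmetric] by (simp add: add_divide_distrib)
      ultimately show ?thesis by (simp add: power2_diff mult.assoc)
    qed
    then have "(\<integral>x. (s i x - s j x)\<^sup>2 \<partial>M) = E (H i) + E (H j) - 2 * E (\<lambda>x. (H i x + H j x) / 2)"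
      using int[OF H] m(2) by (simp add: E_def)
    moreover have "E (H k) \<le> L + 1 / Suc N" if "N \<le> k" for k
    proof -
      have "1 / real (Suc k) \<le> 1 / Suc N" using that by (simp add: frac_le)
      then show ?thesis using EH[of k] L(2)[of k] by linarith
    qed
    ultimately show ?thesis using m(1) that by (smt (verit))
  qed
  obtain r where r: "strict_mono r" and Cau: "AE x in M. Cauchy (\<lambda>i. s (r i) x)"
  proof (rule cauchy_L1_AE_cauchy_subseq[OF int_s])
    fix e :: real assume e: "0 < e"
    define m where "m = measure M (space M) + 1"
    \<comment> \<open>The bound on squares becomes an \<open>L^1\<close> bound through
      \<open>t \<le> \<delta> + t^2 / \<delta>\<close>; with this \<open>\<delta>\<close> the
      constant term costs at most \<open>e / 2\<close>.\<close>
    define \<delta> where "\<delta> = e / (2 * m)"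
    have m: "1 \<le> m" by (simp add: m_def)
    have \<delta>: "0 < \<delta>" using e m by (simp add: \<delta>_def)
    have "(\<lambda>N. 2 * (L + 1 / Suc N - J N)) \<longlonglongrightarrow> 2 * (L + 0 - L)"
      by (intro tendsto_intros L LIMSEQ_Suc[OF lim_1_over_n])
    then have "\<forall>\<^sub>F N in sequentially. 2 * (L + 1 / Suc N - J N) < \<delta> * (e / 2)"
      using e \<delta> by (intro order_tendstoD(2)) auto
    then obtain N where N: "2 * (L + 1 / Suc N - J N) < \<delta> * (e / 2)"
      by (auto simp: eventually_sequentially)
    have "(\<integral>x. norm (s i x - s j x) \<partial>M) < e" if "N \<le> i" "N \<le> j" for i j
    proof -
      have isq: "integrable M (\<lambda>x. (s i x - s j x)\<^sup>2)"
      proof (rule integrable_const_bound[where B=1])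
        show "AE x in M. norm ((s i x - s j x)\<^sup>2) \<le> 1"
        proof (rule AE_I2)
          fix x assume "x \<in> space M"
          then have "\<bar>s i x - s j x\<bar> \<le> 1"
            using s_bd[of x i] s_bd[of x j] by linarith
          then show "norm ((s i x - s j x)\<^sup>2) \<le> 1" by (simp add: abs_square_le_1)
        qed
      qed measurable
      have "(\<integral>x. norm (s i x - s j x) \<partial>M) \<le> (\<integral>x. \<delta> + (s i x - s j x)\<^sup>2 / \<delta> \<partial>M)"
      proof (rule integral_mono)
        fix x
        define t where "t = \<bar>s i x - s j x\<bar>"
        have "t \<le> \<delta> + t\<^sup>2 / \<delta>"
        proof (cases "t \<le> \<delta>")
          case True
          then show ?thesis using \<delta> by (smt (verit) divide_nonneg_pos zero_le_power2)
        next
          case False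
          then have "t * \<delta> \<le> t * t" using \<delta> by (intro mult_left_mono) auto
          then have "t \<le> t\<^sup>2 / \<delta>" using \<delta> by (simp add: pos_le_divide_eq power2_eq_square)
          then show ?thesis using \<delta> by simp
        qed
        then show "norm (s i x - s j x) \<le> \<delta> + (s i x - s j x)\<^sup>2 / \<delta>" by (simp add: t_def)
      qed (use int_s isq in auto)
      also have "\<dots> = \<delta> * measure M (space M) + (\<integral>x. (s i x - s j x)\<^sup>2 \<partial>M) / \<delta>"
        using isq by simp
      also have "\<dots> < \<delta> * m + e / 2"
      proof -
        have "(\<integral>x. (s i x - s j x)\<^sup>2 \<partial>M) < \<delta> * (e / 2)" using sq[OF that] N by linarith
        then have "(\<integral>x. (s i x - s j x)\<^sup>2 \<partial>M) / \<delta> < e / 2"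
          using \<delta> by (simp add: pos_divide_less_eq mult.commute)
        moreover have "\<delta> * measure M (space M) \<le> \<delta> * m"
          using \<delta> by (simp add: m_def)
        ultimately show ?thesis by linarith
      qed
      also have "\<delta> * m + e / 2 = e" using m by (simp add: \<delta>_def)
      finally show ?thesis .
    qed
    then show "\<exists>N. \<forall>i\<ge>N. \<forall>j\<ge>N. LINT x|M. norm (s i x - s j x) < e" by blast
  qed
  have "(\<integral>\<^sup>+x. liminf (\<lambda>n. ennreal (H (r n) x)) \<partial>M) \<le> liminf (\<lambda>n. \<integral>\<^sup>+x. ennreal (H (r n) x) \<partial>M)"
    by (rule nn_integral_liminf) measurable
  also have "\<dots> \<le> B"
    using midpoint_hull_nn_integral[OF H g nn le] by (intro Liminf_le always_eventually) auto
  finally have "(\<integral>\<^sup>+x. liminf (\<lambda>n. ennreal (H (r n) x)) \<partial>M) \<noteq> \<infinity>" using B by auto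
  \<comment> \<open>Convergence of \<open>exp (- H / 2)\<close> alone would allow \<open>H\<close>
    to run off to infinity. The uniform \<open>L^1\<close> bound \<open>B\<close> and Fatou's lemma
    exclude this almost everywhere.\<close>
  then have lim_fin: "AE x in M. liminf (\<lambda>n. ennreal (H (r n) x)) \<noteq> \<infinity>"
    by (intro nn_integral_PInf_AE) measurable
  \<comment> \<open>The absolute value makes \<open>h\<close> nonnegative also where the limit does
    not exist; at points of the space where it exists, nothing changes.\<close>
  define h where "h x = \<bar>lim (\<lambda>n. H (r n) x)\<bar>" for x
  have "h \<in> borel_measurable M" unfolding h_def by measurable
  moreover have "AE x in M. (\<lambda>n. H (r n) x) \<longlonglongrightarrow> h x"
    using Cau lim_fin AE_space
  proof eventually_elim
    case (elim x)
    obtain l where l: "(\<lambda>n. s (r n) x) \<longlonglongrightarrow> l"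
      using elim(1) Cauchy_convergent convergent_def by blast
    have ln_s: "H n x = - 2 * ln (s n x)" for n by (simp add: s_def)
    have "0 \<le> l" using s_bd(1)[OF elim(3)] by (intro LIMSEQ_le_const[OF l]) auto
    moreover have "l \<noteq> 0"
    proof
      assume "l = 0"
      obtain c where c: "0 \<le> c" "liminf (\<lambda>n. ennreal (H (r n) x)) = ennreal c"
        using elim(2) by (cases "liminf (\<lambda>n. ennreal (H (r n) x))") auto
      have "\<forall>\<^sub>F n in sequentially. s (r n) x < exp (- (c + 1) / 2)"
        using l \<open>l = 0\<close> by (intro order_tendstoD(2)) auto
      then have "\<forall>\<^sub>F n in sequentially. ennreal (c + 1) \<le> ennreal (H (r n) x)"
        by eventually_elim (auto simp: s_def intro!: ennreal_leI)
      then have "ennreal (c + 1) \<le> ennreal c" unfolding c(2)[symmetric] by (rule Liminf_bounded)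
      then show False using c(1) by (simp add: ennreal_le_iff)
    qed
    ultimately have "(\<lambda>n. - 2 * ln (s (r n) x)) \<longlonglongrightarrow> - 2 * ln l"
      by (intro tendsto_intros l) auto
    then have conv: "(\<lambda>n. H (r n) x) \<longlonglongrightarrow> - 2 * ln l" by (simp add: ln_s)
    moreover have "0 \<le> - 2 * ln l"
      using pos[OF H elim(3)] by (intro LIMSEQ_le_const[OF conv]) auto
    ultimately show ?case unfolding h_def by (simp add: limI)
  qed
  moreover have "midpoint_hull g n (H (r n))" for n
    by (rule midpoint_hull_antimono[OF H seq_suble[OF r]])
  ultimately show ?thesis
    by (intro exI[of _ "\<lambda>n. H (r n)"] exI[of _ h]) (simp add: h_def)
qed

text \<open>For fixed \<open>x\<close>, \<open>y\<close> and \<open>e\<close>, all late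
  \<open>F i x y\<close> exceed \<open>G x y - e\<close>. One constant left side thus serves a whole
  tail of gradients and all its convex combinations, although the starting index depends on the
  points. The radius \<open>k\<close> is kept, as the modular condition is convex and passes to
  limits by Fatou's lemma.\<close>

lemma hajlasz_inequality_limit:
  fixes M :: "'x::metric_space measure"
  assumes fin: "finite_measure M" and N: "N_function \<Phi>"
    and g: "\<And>i. g i \<in> borel_measurable M" and nn: "\<And>i x. x \<in> space M \<Longrightarrow> 0 \<le> g i x"
    and k: "0 < k" and le: "\<And>i. modular M \<Phi> (g i) k \<le> 1" and S: "S \<in> null_sets M"
    and bd: "\<And>i x y. x \<in> space M - S \<Longrightarrow> y \<in> space M - S \<Longrightarrow> F i x y \<le> dist x y * (g i x + g i y)"
    and lim: "\<And>x y. x \<in> space M - S \<Longrightarrow> y \<in> space M - S \<Longrightarrow> (\<lambda>i. F i x y) \<longlonglongrightarrow> G x y"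
  shows "\<exists>h. \<exists>S' \<in> null_sets M. h \<in> borel_measurable M \<and> (\<forall>x. 0 \<le> h x) \<and> modular M \<Phi> h k \<le> 1 \<and>
     (\<forall>x\<in>space M - S'. \<forall>y\<in>space M - S'. G x y \<le> dist x y * (h x + h y))"
proof -
  interpret finite_measure M by fact
  define B where "B = ennreal k * (emeasure M (space M) + ennreal (1 / \<Phi> 1))"
  have B: "B < \<infinity>"
    unfolding B_def emeasure_eq_measure by (auto simp: ennreal_mult_less_top)
  have "(\<integral>\<^sup>+x. ennreal (g i x) \<partial>M) = (\<integral>\<^sup>+x. ennreal \<bar>g i x\<bar> \<partial>M)" for i
    using nn by (intro nn_integral_cong) auto
  then have leB: "(\<integral>\<^sup>+x. ennreal (g i x) \<partial>M) \<le> B" for i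
    unfolding B_def using nn_integral_le_of_modular[OF N g k le, of i] by simp
  obtain H h where H: "\<And>n. midpoint_hull g n (H n)" and h: "h \<in> borel_measurable M" "\<And>x. 0 \<le> h x"
    and conv: "AE x in M. (\<lambda>n. H n x) \<longlonglongrightarrow> h x"
    using AE_convergent_midpoint_hull[of M g B, OF fin g nn leB B] by auto
  obtain S1 where S1: "S1 \<in> null_sets M" "{x \<in> space M. \<not> (\<lambda>n. H n x) \<longlonglongrightarrow> h x} \<subseteq> S1"
    using conv unfolding eventually_ae_filter by blast
  have meas: "H n \<in> borel_measurable M" for n
    using midpoint_hull_measurable[OF H g] .
  have "modular M \<Phi> h k \<le> 1"
    using midpoint_hull_modular[OF H N g k le]
    by (intro modular_Fatou[OF N meas k conv] always_eventually) auto
  moreover have "G x y \<le> dist x y * (h x + h y)" if "x \<in> space M - (S \<union> S1)" "y \<in> space M - (S \<union> S1)" for x y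
  proof (rule field_le_epsilon)
    fix e :: real assume "0 < e"
    have xy: "x \<in> space M - S" "y \<in> space M - S" using that by auto
    have hx: "(\<lambda>n. H n x) \<longlonglongrightarrow> h x" and hy: "(\<lambda>n. H n y) \<longlonglongrightarrow> h y" using S1(2) that by auto
    have "\<forall>\<^sub>F i in sequentially. G x y - e < F i x y"
      using \<open>0 < e\<close> by (intro order_tendstoD(1)[OF lim[OF xy]]) simp
    then obtain n where n: "\<And>i. n \<le> i \<Longrightarrow> G x y - e < F i x y"
      by (auto simp: eventually_sequentially)
    have "G x y - e \<le> dist x y * (H m x + H m y)" if "n \<le> m" for m
    proof (rule midpoint_hull_sum_ge[OF H])
      fix i assume "m \<le> i"
      then show "G x y - e \<le> dist x y * (g i x + g i y)"
        using n[of i] bd[OF xy, of i] \<open>n \<le> m\<close> by linarith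
    qed
    then have "G x y - e \<le> dist x y * (h x + h y)"
      by (intro LIMSEQ_le_const[OF tendsto_mult[OF tendsto_const tendsto_add[OF hx hy]]]) blast
    then show "G x y \<le> dist x y * (h x + h y) + e" by simp
  qed
  moreover have "S \<union> S1 \<in> null_sets M" using S S1(1) by blast
  ultimately show ?thesis using h by blast
qed

section \<open>Bounded sets under a doubling measure\<close>

text \<open>Greedy choice: a point missed by the balls around the points found so far has distance
  at least \<open>\<epsilon>\<close> from all of them.\<close>

lemma separated_subset_of_card:
  fixes \<Omega> :: "'x::metric_space set"
  assumes "0 < \<epsilon>" and no: "\<And>F. finite F \<Longrightarrow> F \<subseteq> \<Omega> \<Longrightarrow> \<not> \<Omega> \<subseteq> (\<Union>x\<in>F. ball x \<epsilon>)"
  shows "\<exists>F. finite F \<and> F \<subseteq> \<Omega> \<and> card F = n \<and> (\<forall>x\<in>F. \<forall>y\<in>F. x \<noteq> y \<longrightarrow> \<epsilon> \<le> dist x y)"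
proof (induction n)
  case 0
  then show ?case by (intro exI[of _ "{}"]) auto
next
  case (Suc n)
  then obtain F where F: "finite F" "F \<subseteq> \<Omega>" "card F = n" "\<forall>x\<in>F. \<forall>y\<in>F. x \<noteq> y \<longrightarrow> \<epsilon> \<le> dist x y"
    by blast
  obtain z where z: "z \<in> \<Omega>" "z \<notin> (\<Union>x\<in>F. ball x \<epsilon>)" using no[OF F(1,2)] by blast
  then have "z \<notin> F" using \<open>0 < \<epsilon>\<close> by force
  moreover have "\<forall>x\<in>insert z F. \<forall>y\<in>insert z F. x \<noteq> y \<longrightarrow> \<epsilon> \<le> dist x y"
    using F(4) z(2) by (auto simp: dist_commute not_less)
  ultimately show ?case using F z(1) by (intro exI[of _ "insert z F"]) auto
qed

text \<open>Volume packing. Balls of radius \<open>\<epsilon> / 2\<close> around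
  \<open>\<epsilon>\<close>-separated points of \<open>\<Omega>\<close> are disjoint and lie in one
  ball \<open>B0\<close>; by iterated doubling each carries at least a fixed fraction of the measure
  of \<open>B0\<close>, which bounds their number.\<close>

lemma doubling_measure_bounded_imp_finite_net:
  fixes \<mu> :: "'x::metric_space measure" and \<Omega> :: "'x set"
  assumes sets: "sets \<mu> = sets borel" and doubling: "doubling_measure \<mu>" and bdd: "bounded \<Omega>" and \<epsilon>: "0 < \<epsilon>"
  shows "\<exists>F. finite F \<and> F \<subseteq> \<Omega> \<and> \<Omega> \<subseteq> (\<Union>x\<in>F. ball x \<epsilon>)"
proof (rule ccontr)
  assume "\<not> ?thesis"
  then have no: "\<And>F. finite F \<Longrightarrow> F \<subseteq> \<Omega> \<Longrightarrow> \<not> \<Omega> \<subseteq> (\<Union>x\<in>F. ball x \<epsilon>)" by blast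
  obtain Cd where Cd: "\<And>x r. 0 < r \<Longrightarrow> 0 < emeasure \<mu> (ball x r)"
      "\<And>x r. 0 < r \<Longrightarrow> emeasure \<mu> (ball x (2 * r)) < \<infinity>"
      "\<And>x r. 0 < r \<Longrightarrow> emeasure \<mu> (ball x (2 * r)) \<le> ennreal Cd * emeasure \<mu> (ball x r)"
    using doubling unfolding doubling_measure_def by blast
  have iter: "emeasure \<mu> (ball x (2 ^ p * r)) \<le> ennreal Cd ^ p * emeasure \<mu> (ball x r)" if "0 < r" for x r p
  proof (induction p)
    case (Suc p)
    have "emeasure \<mu> (ball x (2 ^ Suc p * r)) \<le> ennreal Cd * emeasure \<mu> (ball x (2 ^ p * r))"
      using Cd(3)[of "2 ^ p * r" x] that by (simp add: mult.assoc)
    also have "\<dots> \<le> ennreal Cd * (ennreal Cd ^ p * emeasure \<mu> (ball x r))"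
      by (intro mult_left_mono Suc) auto
    finally show ?case by (simp add: mult.assoc)
  qed simp
  have fin: "emeasure \<mu> (ball x r) < \<infinity>" if "0 < r" for x r
    using Cd(2)[of "r/2" x] that by simp
  obtain x0 R where R: "0 < R" "\<Omega> \<subseteq> ball x0 R"
    using bounded_subset_ballD[OF bdd, of undefined] by blast
  define B0 where "B0 = ball x0 (R + \<epsilon>)"
  \<comment> \<open>After \<open>p\<close> doublings, a ball of radius \<open>\<epsilon> / 2\<close>
    around any point of \<open>\<Omega>\<close> contains \<open>B0\<close>, since points of
    \<open>\<Omega>\<close> and of \<open>B0\<close> have distance less than
    \<open>2 * R + 2 * \<epsilon>\<close>.\<close>
  obtain p :: nat where "(2 * R + 2 * \<epsilon>) / (\<epsilon> / 2) < 2 ^ p"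
    using real_arch_pow[of 2] by auto
  then have p: "2 * R + 2 * \<epsilon> < 2 ^ p * (\<epsilon> / 2)"
    using \<epsilon> by (simp add: pos_divide_less_eq)
  define \<beta> where "\<beta> = measure \<mu> B0"
  have \<beta>: "emeasure \<mu> B0 = ennreal \<beta>" "0 < \<beta>"
  proof -
    show e: "emeasure \<mu> B0 = ennreal \<beta>"
      unfolding \<beta>_def using fin[of "R + \<epsilon>" x0] R \<epsilon> by (intro emeasure_eq_ennreal_measure) (auto simp: B0_def)
    show "0 < \<beta>" using Cd(1)[of "R + \<epsilon>" x0] R \<epsilon> e by (simp add: B0_def)
  qed
  \<comment> \<open>The doubling constant is only known to be real, and \<open>ennreal\<close>
    truncates it at 0; hence the maximum.\<close>
  obtain n :: nat where n: "max 0 Cd ^ p < n" using reals_Archimedean2 by blast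
  obtain F where F: "finite F" "F \<subseteq> \<Omega>" "card F = n" "\<forall>x\<in>F. \<forall>y\<in>F. x \<noteq> y \<longrightarrow> \<epsilon> \<le> dist x y"
    using separated_subset_of_card[of \<epsilon> \<Omega> n, OF \<epsilon> no] by auto
  have "of_nat n * emeasure \<mu> B0 = (\<Sum>x\<in>F. emeasure \<mu> B0)" using F by simp
  also have "\<dots> \<le> (\<Sum>x\<in>F. ennreal Cd ^ p * emeasure \<mu> (ball x (\<epsilon> / 2)))"
  proof (rule sum_mono)
    fix x assume "x \<in> F"
    then have "dist x0 x < R" using F R by auto
    have "B0 \<subseteq> ball x (2 ^ p * (\<epsilon> / 2))"
    proof
      fix z assume "z \<in> B0"
      then have "dist x z < 2 * R + 2 * \<epsilon>"
        using \<open>dist x0 x < R\<close> \<epsilon> dist_triangle3[of x z x0] by (simp add: B0_def)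
      then show "z \<in> ball x (2 ^ p * (\<epsilon> / 2))" using p by simp
    qed
    then have "emeasure \<mu> B0 \<le> emeasure \<mu> (ball x (2 ^ p * (\<epsilon> / 2)))"
      by (intro emeasure_mono) (auto simp: sets)
    also have "\<dots> \<le> ennreal Cd ^ p * emeasure \<mu> (ball x (\<epsilon> / 2))" using \<epsilon> by (intro iter) simp
    finally show "emeasure \<mu> B0 \<le> ennreal Cd ^ p * emeasure \<mu> (ball x (\<epsilon> / 2))" .
  qed
  also have "\<dots> = ennreal Cd ^ p * (\<Sum>x\<in>F. emeasure \<mu> (ball x (\<epsilon> / 2)))"
    by (simp add: sum_distrib_left)
  also have "(\<Sum>x\<in>F. emeasure \<mu> (ball x (\<epsilon> / 2))) = emeasure \<mu> (\<Union>x\<in>F. ball x (\<epsilon> / 2))"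
  proof (rule sum_emeasure)
    show "disjoint_family_on (\<lambda>x. ball x (\<epsilon> / 2)) F"
      unfolding disjoint_family_on_def
    proof (intro ballI impI)
      fix x y assume "x \<in> F" "y \<in> F" "x \<noteq> y"
      then have "\<epsilon> \<le> dist x y" using F by blast
      then have "\<not> (dist x z < \<epsilon> / 2 \<and> dist y z < \<epsilon> / 2)" for z
        using dist_triangle2[of x y z] by linarith
      then show "ball x (\<epsilon> / 2) \<inter> ball y (\<epsilon> / 2) = {}"
        unfolding disjoint_iff mem_ball by blast
    qed
  qed (use F in \<open>auto simp: sets\<close>)
  also have "\<dots> \<le> emeasure \<mu> B0"
  proof (rule emeasure_mono)
    show "(\<Union>x\<in>F. ball x (\<epsilon> / 2)) \<subseteq> B0"
    proof
      fix z assume "z \<in> (\<Union>x\<in>F. ball x (\<epsilon> / 2))"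
      then obtain x where x: "x \<in> F" "dist x z < \<epsilon> / 2" by auto
      then have "dist x0 x < R" using F R by auto
      then show "z \<in> B0" using x \<epsilon> dist_triangle[of x0 z x] by (simp add: B0_def)
    qed
  qed (simp add: sets B0_def)
  finally have "of_nat n * emeasure \<mu> B0 \<le> ennreal Cd ^ p * emeasure \<mu> B0"
    by (simp add: mult_left_mono)
  moreover have "ennreal Cd ^ p = ennreal (max 0 Cd ^ p)"
    by (subst ennreal_power[symmetric]) (auto simp: max_def ennreal_neg)
  moreover have "of_nat n = ennreal (real n)" by (simp add: ennreal_of_nat_eq_real_of_nat)
  ultimately have "ennreal (real n * \<beta>) \<le> ennreal (max 0 Cd ^ p * \<beta>)"
    using \<beta> by (simp add: ennreal_mult)
  then have "real n * \<beta> \<le> max 0 Cd ^ p * \<beta>" using \<beta> by (subst (asm) ennreal_le_iff) auto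
  then show False using n \<beta>(2) by simp
qed

text \<open>Taking the least index of a ball that contains the point turns overlapping balls into
  disjoint Borel cells. The partition is encoded by this index function, so that step maps take the
  form \<open>q (I x)\<close>.\<close>

lemma finite_net_measurable_partition:
  fixes \<Omega> :: "'x::metric_space set"
  assumes "finite F" "\<Omega> \<subseteq> (\<Union>x\<in>F. ball x (\<epsilon> / 2))"
  obtains I :: "'x \<Rightarrow> nat" and n where "I \<in> measurable borel (count_space UNIV)"
    "\<And>x. x \<in> \<Omega> \<Longrightarrow> I x < n" "\<And>x y. x \<in> \<Omega> \<Longrightarrow> y \<in> \<Omega> \<Longrightarrow> I x = I y \<Longrightarrow> dist x y \<le> \<epsilon>"
proof -
  obtain c and n :: nat where c: "F = c ` {i. i < n}"
    using \<open>finite F\<close> by (metis finite_imp_nat_seg_image_inj_on)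
  define I where "I x = (LEAST i. x \<in> ball (c i) (\<epsilon> / 2))" for x
  have ex: "\<exists>i<n. x \<in> ball (c i) (\<epsilon> / 2)" if "x \<in> \<Omega>" for x
    using assms(2) that unfolding c by blast
  have I: "x \<in> ball (c (I x)) (\<epsilon> / 2)" if "x \<in> \<Omega>" for x
    using ex[OF that] unfolding I_def by (auto intro: LeastI)
  show ?thesis
  proof
    show "I \<in> measurable borel (count_space UNIV)"
      unfolding I_def by (rule measurable_Least) (simp only: pred_def space_borel Collect_mem_eq Int_UNIV_left open_ball borel_open UNIV_I simp_thms)
    show "I x < n" if "x \<in> \<Omega>" for x
      using ex[OF that] unfolding I_def by (auto intro: le_less_trans[OF Least_le])
    show "dist x y \<le> \<epsilon>" if "x \<in> \<Omega>" "y \<in> \<Omega>" "I x = I y" for x y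
      using I[OF that(1)] I[OF that(2)] that(3) dist_triangle3[of x y "c (I y)"] by simp
  qed
qed

section \<open>Maps into metric spaces\<close>

lemma space_borel_of_metric [simp]: "space (borel_of_metric Y) = mspace Y"
  unfolding borel_of_metric_def by (subst space_measure_of) (auto dest!: openin_subset)

lemma openin_sets_borel_of_metric:
  "openin (mtopology_of Y) U \<Longrightarrow> U \<in> sets (borel_of_metric Y)"
  unfolding borel_of_metric_def by (subst sets_measure_of) (use openin_subset in fastforce)+

lemma measurable_borel_of_metricI:
  assumes "\<And>x. x \<in> space M \<Longrightarrow> f x \<in> mspace Y"
    and "\<And>U. openin (mtopology_of Y) U \<Longrightarrow> f -` U \<inter> space M \<in> sets M"
  shows "f \<in> measurable M (borel_of_metric Y)"
  unfolding borel_of_metric_def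
proof (rule measurable_measure_of)
  show "{U. openin (mtopology_of Y) U} \<subseteq> Pow (mspace Y)" by (auto dest!: openin_subset)
qed (use assms in auto)

lemma openin_mball_of: "openin (mtopology_of Y) (mball_of Y y r)"
  using Metric_space.openin_mball[OF Metric_space_mspace_mdist] by (simp add: mtopology_of_def mball_of_def)

lemma openin_mtopology_of_ball:
  assumes "openin (mtopology_of Y) U" "y \<in> U"
  obtains r where "0 < r" "mball_of Y y r \<subseteq> U"
  using assms Metric_space.openin_mtopology[OF Metric_space_mspace_mdist, of Y U]
  by (auto simp: mtopology_of_def mball_of_def)

lemma measurable_mdist_const:
  assumes f: "f \<in> measurable M (borel_of_metric Y)" and y: "y \<in> mspace Y"
  shows "(\<lambda>x. mdist Y y (f x)) \<in> borel_measurable M"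
proof (rule borel_measurableI_less)
  fix r
  have "f -` mball_of Y y r \<inter> space M \<in> sets M"
    by (rule measurable_sets[OF f openin_sets_borel_of_metric[OF openin_mball_of]])
  also have "f -` mball_of Y y r \<inter> space M = {x \<in> space M. mdist Y y (f x) < r}"
    using measurable_space[OF f] y by (auto simp: in_mball_of)
  finally show "{x \<in> space M. mdist Y y (f x) < r} \<in> sets M" .
qed

lemma isometric_embedding_measurable:
  assumes "isometric_embedding Y Z \<phi>"
  shows "\<phi> \<in> measurable (borel_of_metric Y) (borel_of_metric Z)"
proof (rule measurable_borel_of_metricI)
  show "\<phi> x \<in> mspace Z" if "x \<in> space (borel_of_metric Y)" for x
    using assms that by (auto simp: isometric_embedding_def)
  fix U assume U: "openin (mtopology_of Z) U"
  have "openin (mtopology_of Y) (\<phi> -` U \<inter> mspace Y)"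
    unfolding mtopology_of_def Metric_space.openin_mtopology[OF Metric_space_mspace_mdist]
  proof (intro conjI allI impI)
    fix y assume y: "y \<in> \<phi> -` U \<inter> mspace Y"
    then obtain r where r: "0 < r" "mball_of Z (\<phi> y) r \<subseteq> U"
      using openin_mtopology_of_ball[OF U] by blast
    have "Metric_space.mball (mspace Y) (mdist Y) y r \<subseteq> \<phi> -` U \<inter> mspace Y"
    proof
      fix z assume "z \<in> Metric_space.mball (mspace Y) (mdist Y) y r"
      then have z: "z \<in> mspace Y" "mdist Y y z < r"
        using in_mball_of[of z Y y r] by (simp_all add: mball_of_def)
      then have "\<phi> z \<in> mball_of Z (\<phi> y) r"
        using assms y by (auto simp: in_mball_of isometric_embedding_def)
      then show "z \<in> \<phi> -` U \<inter> mspace Y" using r z by auto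
    qed
    then show "\<exists>r>0. Metric_space.mball (mspace Y) (mdist Y) y r \<subseteq> \<phi> -` U \<inter> mspace Y"
      using r by blast
  qed auto
  then show "\<phi> -` U \<inter> space (borel_of_metric Y) \<in> sets (borel_of_metric Y)"
    using openin_sets_borel_of_metric by simp
qed

text \<open>The points of \<open>V k\<close> have room \<open>1 / Suc k\<close> inside
  \<open>U\<close>, so an error below that size cannot lead from \<open>V k\<close> out of
  \<open>U\<close>. The preimage of \<open>U\<close> under the limit thus becomes a countable
  combination of preimages of open sets, without separability of \<open>Z\<close>.\<close>

lemma measurable_borel_of_metric_limit:
  assumes w: "\<And>j. w j \<in> measurable M (borel_of_metric Z)"
    and v: "\<And>x. x \<in> space M \<Longrightarrow> v x \<in> mspace Z"
    and lim: "\<And>x. x \<in> space M \<Longrightarrow> (\<lambda>j. mdist Z (w j x) (v x)) \<longlonglongrightarrow> 0"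
  shows "v \<in> measurable M (borel_of_metric Z)"
proof (rule measurable_borel_of_metricI[OF v])
  fix U assume U: "openin (mtopology_of Z) U"
  have wZ: "w j x \<in> mspace Z" if "x \<in> space M" for j x
    using measurable_space[OF w that] by simp
  define V where "V k = \<Union> {mball_of Z z s |z s. mball_of Z z (s + 1 / Suc k) \<subseteq> U \<and> z \<in> mspace Z}" for k :: nat
  have "openin (mtopology_of Z) (V k)" for k
    unfolding V_def by (rule openin_Union) (auto intro: openin_mball_of)
  then have meas: "w j -` V k \<inter> space M \<in> sets M" for j k
    by (intro measurable_sets[OF w] openin_sets_borel_of_metric)
  have "v -` U \<inter> space M = (\<Union>k. \<Union>n. \<Inter>j\<in>{n..}. w j -` V k \<inter> space M)"
  proof (intro equalityI subsetI)
    fix x assume "x \<in> v -` U \<inter> space M"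
    then have x: "v x \<in> U" "x \<in> space M" by auto
    obtain r where r: "0 < r" "mball_of Z (v x) r \<subseteq> U" using openin_mtopology_of_ball[OF U x(1)] .
    obtain k where k: "1 / real (Suc k) < r / 2"
      using nat_approx_posE[of "r/2"] r by auto
    have "\<forall>\<^sub>F j in sequentially. mdist Z (w j x) (v x) < 1 / Suc k"
      using lim[OF x(2)] by (rule order_tendstoD) simp
    then obtain n where n: "\<And>j. n \<le> j \<Longrightarrow> mdist Z (w j x) (v x) < 1 / Suc k"
      by (auto simp: eventually_sequentially)
    \<comment> \<open>One copy of \<open>1 / Suc k\<close> is the radius of a ball around
      \<open>v x\<close> that contains \<open>w j x\<close>, the other is the margin that
      \<open>V k\<close> demands; both fit because \<open>1 / Suc k < r / 2\<close>.\<close>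
    have "mball_of Z (v x) (1 / Suc k + 1 / Suc k) \<subseteq> U"
      using r(2) k by (force simp: subset_iff in_mball_of)
    then have "w j x \<in> V k" if "n \<le> j" for j
      unfolding V_def using n[OF that] v[OF x(2)] wZ[OF x(2)] 
      by (intro UnionI[of "mball_of Z (v x) (1 / Suc k)"] CollectI exI[of _ "v x"] exI[of _ "1 / Suc k"])
        (auto simp: in_mball_of mdist_commute)
    then show "x \<in> (\<Union>k. \<Union>n. \<Inter>j\<in>{n..}. w j -` V k \<inter> space M)" using x by blast
  next
    fix x assume "x \<in> (\<Union>k. \<Union>n. \<Inter>j\<in>{n..}. w j -` V k \<inter> space M)"
    then obtain k n where *: "\<forall>j\<in>{n..}. x \<in> w j -` V k \<inter> space M" by blast
    then have V: "\<And>j. n \<le> j \<Longrightarrow> w j x \<in> V k" by simp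
    have x: "x \<in> space M" using bspec[OF *, of n] by simp
    have "\<forall>\<^sub>F j in sequentially. mdist Z (w j x) (v x) < 1 / Suc k"
      using lim[OF x] by (rule order_tendstoD) simp
    then obtain n' where n': "\<And>j. n' \<le> j \<Longrightarrow> mdist Z (w j x) (v x) < 1 / Suc k"
      by (auto simp: eventually_sequentially)
    define j where "j = max n n'"
    have "w j x \<in> V k" "mdist Z (w j x) (v x) < 1 / Suc k" using V n' by (auto simp: j_def)
    then obtain z s where z: "w j x \<in> mball_of Z z s" "mball_of Z z (s + 1 / Suc k) \<subseteq> U" "z \<in> mspace Z"
      unfolding V_def by blast
    have "mdist Z z (v x) < s + 1 / Suc k"
      using mdist_triangle[OF z(3) wZ[OF x, of j] v[OF x]] z(1) \<open>mdist Z (w j x) (v x) < 1 / Suc k\<close>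
      by (simp add: in_mball_of)
    then have "v x \<in> mball_of Z z (s + 1 / Suc k)" using z(3) v[OF x] by (simp add: in_mball_of)
    then show "x \<in> v -` U \<inter> space M" using z(2) x by auto
  qed
  also have "\<dots> \<in> sets M"
  proof -
    have "(\<Inter>j\<in>{n..}. w j -` V k \<inter> space M) \<in> sets M" for n k
      using meas by (intro sets.countable_INT') auto
    then show ?thesis
      by (intro sets.countable_UN image_subsetI)
  qed
  finally show "v -` U \<inter> space M \<in> sets M" .
qed

lemma measurable_countable_valued:
  fixes P :: "nat \<Rightarrow> 'z"
  assumes "\<And>i. P i \<in> mspace Z" "I \<in> measurable M (count_space UNIV)"
  shows "(\<lambda>x. P (I x)) \<in> measurable M (borel_of_metric Z)"
  by (rule measurable_compose[OF assms(2)]) (simp add: assms(1))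

text \<open>In a non-separable target the distance of two Borel maps need not be measurable. If one
  of them takes its values in a sequence, the distance is pieced together from distances to single
  points.\<close>

lemma measurable_mdist_countable_valued:
  fixes P :: "nat \<Rightarrow> 'z"
  assumes "\<And>i. P i \<in> mspace Z" "I \<in> measurable M (count_space UNIV)" "f \<in> measurable M (borel_of_metric Z)"
  shows "(\<lambda>x. mdist Z (f x) (P (I x))) \<in> borel_measurable M"
  unfolding mdist_commute[of Z "f _"]
  by (rule measurable_compose_countable[OF measurable_mdist_const[OF assms(3,1)] assms(2)])

lemma MCauchy_of_summable:
  assumes w: "\<And>j. w j \<in> mspace Z" and s: "summable (\<lambda>j. mdist Z (w j) (w (Suc j)))"
  shows "Metric_space.MCauchy (mspace Z) (mdist Z) w"
proof -
  define S where "S n = (\<Sum>j<n. mdist Z (w j) (w (Suc j)))" for n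
  have le: "mdist Z (w m) (w n) \<le> S n - S m" if "m \<le> n" for m n
    using that
  proof (induction n rule: dec_induct)
    case base
    show ?case using mdist_zero[OF w w, of m m] by simp
  next
    case (step n)
    then show ?case using mdist_triangle[OF w[of m] w[of n] w[of "Suc n"]] by (simp add: S_def)
  qed
  have le': "mdist Z (w m) (w n) \<le> \<bar>S m - S n\<bar>" for m n
    using le[of m n] le[of n m] mdist_commute[of Z "w m" "w n"] by (cases "m \<le> n") auto
  have "convergent S" using s unfolding S_def by (simp add: summable_iff_convergent)
  then have "Cauchy S" by (rule convergent_Cauchy)
  then show ?thesis
    unfolding Metric_space.MCauchy_def[OF Metric_space_mspace_mdist] Cauchy_def dist_real_def
    using w le' by (metis image_subset_iff le_less_trans)
qed

lemma mdist_self: "x \<in> mspace Z \<Longrightarrow> mdist Z x x = 0"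
  by simp

lemma tendsto_mdist:
  assumes "\<And>j. a j \<in> mspace Z" "\<And>j. b j \<in> mspace Z" "a' \<in> mspace Z" "b' \<in> mspace Z"
    and a: "(\<lambda>j. mdist Z (a j) a') \<longlonglongrightarrow> 0" and b: "(\<lambda>j. mdist Z (b j) b') \<longlonglongrightarrow> 0"
  shows "(\<lambda>j. mdist Z (a j) (b j)) \<longlonglongrightarrow> mdist Z a' b'"
proof -
  have le: "norm (mdist Z (a j) (b j) - mdist Z a' b') \<le> mdist Z (a j) a' + mdist Z (b j) b'" for j
    using mdist_triangle[of "a j" Z a' "b j"] mdist_triangle[of a' Z b' "b j"]
      mdist_triangle[of a' Z "a j" b'] mdist_triangle[of "a j" Z "b j" b'] assms(1-4)
      mdist_commute[of Z a' "a j"] mdist_commute[of Z b' "b j"] by auto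
  have "(\<lambda>j. mdist Z (a j) a' + mdist Z (b j) b') \<longlonglongrightarrow> 0"
    using tendsto_add[OF a b] by simp
  with always_eventually[OF allI[OF le]] have "(\<lambda>j. mdist Z (a j) (b j) - mdist Z a' b') \<longlonglongrightarrow> 0"
    by (rule Lim_null_comparison)
  then show ?thesis by (rule LIM_zero_cancel)
qed

text \<open>Riesz-Fischer with geometric rates: the distances of consecutive step maps are summable
  in \<open>L^1\<close>, so the values are Cauchy almost everywhere. Measurability of the distance
  to \<open>v\<close> is part of the conclusion because it does not follow from that of the two
  maps; it is inherited from the step maps.\<close>

lemma Orlicz_Cauchy_limit:
  fixes P :: "nat \<Rightarrow> nat \<Rightarrow> 'z" and I :: "nat \<Rightarrow> 'a \<Rightarrow> nat"
  assumes fin: "finite_measure M" and N: "N_function \<Phi>" and Z: "mcomplete_of Z"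
    and P: "\<And>j i. P j i \<in> mspace Z" and I: "\<And>j. I j \<in> measurable M (count_space UNIV)" and C: "0 < C"
    and cau: "\<And>i j. j \<le> i \<Longrightarrow> modular M \<Phi> (\<lambda>x. mdist Z (P j (I j x)) (P i (I i x))) (C * (1/2) ^ j) \<le> 1"
  shows "\<exists>v. v \<in> measurable M (borel_of_metric Z) \<and>
     (\<forall>f \<in> measurable M (borel_of_metric Z). (\<lambda>x. mdist Z (f x) (v x)) \<in> borel_measurable M) \<and>
     (\<forall>j. modular M \<Phi> (\<lambda>x. mdist Z (P j (I j x)) (v x)) (C * (1/2) ^ j) \<le> 1)"
proof -
  interpret finite_measure M by fact
  define w where "w j x = P j (I j x)" for j x
  have wZ: "w j x \<in> mspace Z" for j x by (simp add: w_def P)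
  have w_meas: "w j \<in> measurable M (borel_of_metric Z)" for j
    unfolding w_def by (rule measurable_countable_valued[OF P I])
  have ww_meas [measurable]: "(\<lambda>x. mdist Z (w j x) (w i x)) \<in> borel_measurable M" for i j
    unfolding w_def by (rule measurable_mdist_countable_valued[OF P I w_meas[unfolded w_def]])
  define A where "A = emeasure M (space M) + ennreal (1 / \<Phi> 1)"
  have A: "A < \<infinity>" unfolding A_def emeasure_eq_measure by simp
  have "(\<integral>\<^sup>+x. (\<Sum>j. ennreal (mdist Z (w j x) (w (Suc j) x))) \<partial>M)
      = (\<Sum>j. \<integral>\<^sup>+x. ennreal (mdist Z (w j x) (w (Suc j) x)) \<partial>M)"
    by (rule nn_integral_suminf) measurable
  also have "\<dots> \<le> (\<Sum>j. ennreal (C * (1/2) ^ j) * A)"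
  proof (rule suminf_le)
    fix j
    show "(\<integral>\<^sup>+x. ennreal (mdist Z (w j x) (w (Suc j) x)) \<partial>M) \<le> ennreal (C * (1/2) ^ j) * A"
      using nn_integral_le_of_modular[OF N ww_meas, of "C * (1/2) ^ j" j "Suc j"] cau[of j "Suc j"] C
      by (simp add: A_def w_def)
  qed auto
  also have "\<dots> = ennreal (\<Sum>j. C * (1/2) ^ j) * A"
    using C by (simp add: suminf_ennreal2 summable_mult summable_geometric ennreal_suminf_multc)
  also have "\<dots> < \<infinity>" using A by (simp add: ennreal_mult_less_top)
  finally have "AE x in M. (\<Sum>j. ennreal (mdist Z (w j x) (w (Suc j) x))) \<noteq> \<infinity>"
    by (intro nn_integral_PInf_AE) (auto simp: less_top)
  then obtain S where S: "S \<in> null_sets M"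
    and fin_sum: "\<And>x. x \<in> space M - S \<Longrightarrow> (\<Sum>j. ennreal (mdist Z (w j x) (w (Suc j) x))) \<noteq> \<infinity>"
    unfolding eventually_ae_filter by blast
  have "\<exists>z \<in> mspace Z. (\<lambda>j. mdist Z (w j x) z) \<longlonglongrightarrow> 0" if "x \<in> space M - S" for x
  proof -
    have "summable (\<lambda>j. mdist Z (w j x) (w (Suc j) x))"
      using fin_sum[OF that] by (intro summable_suminf_not_top) auto
    then have "Metric_space.MCauchy (mspace Z) (mdist Z) (\<lambda>j. w j x)"
      by (rule MCauchy_of_summable[OF wZ])
    then obtain z where "limitin (Metric_space.mtopology (mspace Z) (mdist Z)) (\<lambda>j. w j x) z sequentially"
      using Z unfolding mcomplete_of_def Metric_space.mcomplete_def[OF Metric_space_mspace_mdist] by blast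
    then show ?thesis
      unfolding Metric_space.limitin_metric_dist_null[OF Metric_space_mspace_mdist] by blast
  qed
  then obtain v0 where v0: "\<And>x. x \<in> space M - S \<Longrightarrow> v0 x \<in> mspace Z"
      "\<And>x. x \<in> space M - S \<Longrightarrow> (\<lambda>j. mdist Z (w j x) (v0 x)) \<longlonglongrightarrow> 0"
    by metis
  define v where "v x = (if x \<in> S then P 0 0 else v0 x)" for x
  \<comment> \<open>Label 0 is set aside for the constant value on the null set \<open>S\<close>,
    and the old labels move up by one. The modified step maps still take their values in a sequence
    and now converge to \<open>v\<close> at every point of the space, as the measurability lemmas
    demand.\<close>
  define P' where "P' j i = (case i of 0 \<Rightarrow> P 0 0 | Suc i \<Rightarrow> P j i)" for j i
  define I' where "I' j x = (if x \<in> S then 0 else Suc (I j x))" for j x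
  have P': "P' j i \<in> mspace Z" for j i by (cases i) (auto simp: P'_def P)
  have S_sets: "S \<in> sets M" using S by auto
  have I': "I' j \<in> measurable M (count_space UNIV)" for j
  proof -
    have "(\<lambda>x. Suc (I j x)) \<in> measurable M (count_space UNIV)"
      by (rule measurable_compose[OF I]) simp
    then show ?thesis
      unfolding I'_def using S_sets by (intro measurable_If_set) auto
  qed
  have vZ: "v x \<in> mspace Z" if "x \<in> space M" for x
    using v0(1)[of x] that P by (auto simp: v_def)
  have lim': "(\<lambda>j. mdist Z (P' j (I' j x)) (v x)) \<longlonglongrightarrow> 0" if "x \<in> space M" for x
    using v0(2)[of x] that by (cases "x \<in> S") (auto simp: v_def P'_def I'_def w_def mdist_self P)
  have v_meas: "v \<in> measurable M (borel_of_metric Z)"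
    by (rule measurable_borel_of_metric_limit[of "\<lambda>j x. P' j (I' j x)", OF _ vZ lim'])
      (rule measurable_countable_valued[OF P' I'])
  have d_meas: "(\<lambda>x. mdist Z (f x) (v x)) \<in> borel_measurable M" if f: "f \<in> measurable M (borel_of_metric Z)" for f
  proof (rule borel_measurable_LIMSEQ_real)
    show "(\<lambda>x. mdist Z (f x) (P' j (I' j x))) \<in> borel_measurable M" for j
      by (rule measurable_mdist_countable_valued[OF P' I' f])
    fix x assume x: "x \<in> space M"
    have fx: "f x \<in> mspace Z" using measurable_space[OF f x] by simp
    show "(\<lambda>j. mdist Z (f x) (P' j (I' j x))) \<longlonglongrightarrow> mdist Z (f x) (v x)"
      by (rule tendsto_mdist) (simp_all add: fx P' vZ[OF x] lim'[OF x] mdist_self)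
  qed
  have "modular M \<Phi> (\<lambda>x. mdist Z (w j x) (v x)) (C * (1/2) ^ j) \<le> 1" for j
  proof (rule modular_Fatou[OF N ww_meas[of j]])
    have AE_S: "AE x in M. x \<notin> S" by (rule AE_not_in[OF S])
    show "AE x in M. (\<lambda>i. mdist Z (w j x) (w i x)) \<longlonglongrightarrow> mdist Z (w j x) (v x)"
      using AE_S AE_space
    proof eventually_elim
      case (elim x)
      have x: "x \<in> space M - S" using elim by auto
      have vx: "v x = v0 x" using elim by (simp add: v_def)
      show ?case
        unfolding vx by (rule tendsto_mdist) (simp_all add: wZ v0[OF x] mdist_self)
    qed
    show "\<forall>\<^sub>F i in sequentially. modular M \<Phi> (\<lambda>x. mdist Z (w j x) (w i x)) (C * (1/2) ^ j) \<le> 1"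
      using eventually_ge_at_top[of j] by eventually_elim (simp add: w_def cau)
  qed (use C in simp)
  then show ?thesis
    using v_meas d_meas unfolding w_def by blast
qed

text \<open>Assumption \<open>ev\<close> expresses that the Luxemburg norms tend to 0. This passes
  to \<open>L^1\<close>, where some subsequence converges almost everywhere.\<close>

lemma modular_convergence_AE_subseq:
  assumes fin: "finite_measure M" and N: "N_function \<Phi>"
    and f: "\<And>k. f k \<in> borel_measurable M"
    and ev: "\<And>e. 0 < e \<Longrightarrow> \<forall>\<^sub>F k in sequentially. modular M \<Phi> (f k) e \<le> 1"
  obtains r :: "nat \<Rightarrow> nat" where "strict_mono r" "AE x in M. (\<lambda>n. f (r n) x) \<longlonglongrightarrow> 0"
proof -
  interpret finite_measure M by fact
  define A where "A = measure M (space M) + 1 / \<Phi> 1"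
  have A: "0 < A" unfolding A_def using N_function_pos[OF N, of 1] by (simp add: add_nonneg_pos)
  have bd: "(\<integral>\<^sup>+x. ennreal (norm (f k x)) \<partial>M) \<le> ennreal (e * A)" if "0 < e" "modular M \<Phi> (f k) e \<le> 1" for k e
  proof -
    have "ennreal (e * A) = ennreal e * (emeasure M (space M) + ennreal (1 / \<Phi> 1))"
      unfolding A_def emeasure_eq_measure using that(1) N_function_pos[OF N, of 1]
      by (subst ennreal_mult, simp, simp, subst ennreal_plus) auto
    then show ?thesis using nn_integral_le_of_modular[OF N f that] by simp
  qed
  \<comment> \<open>Integrability is known only once the modular at radius 1 is bounded, hence the
    shift of the sequence by \<open>k0\<close>.\<close>
  obtain k0 where k0: "\<And>k. k0 \<le> k \<Longrightarrow> modular M \<Phi> (f k) 1 \<le> 1"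
    using ev[of 1] by (auto simp: eventually_sequentially)
  have int: "integrable M (f (n + k0))" for n
    using bd[OF _ k0, of "n + k0"] f
    by (intro integrableI_bounded) (auto simp: order_le_less_trans[OF _ ennreal_less_top])
  have lim: "(\<lambda>n. \<integral>x. norm (f (n + k0) x) \<partial>M) \<longlonglongrightarrow> 0"
  proof (rule LIMSEQ_I)
    fix e :: real assume "0 < e"
    then have e: "0 < e / (2 * A)" using A by simp
    obtain n0 where n0: "\<And>k. n0 \<le> k \<Longrightarrow> modular M \<Phi> (f k) (e / (2 * A)) \<le> 1"
      using ev[OF e] by (auto simp: eventually_sequentially)
    have "norm ((\<integral>x. norm (f (n + k0) x) \<partial>M) - 0) < e" if "n0 \<le> n" for n
    proof -
      have "ennreal (\<integral>x. norm (f (n + k0) x) \<partial>M) = (\<integral>\<^sup>+x. ennreal (norm (f (n + k0) x)) \<partial>M)"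
        using int[of n] by (intro nn_integral_eq_integral[symmetric]) auto
      also have "\<dots> \<le> ennreal (e / (2 * A) * A)" using n0 that by (intro bd[OF e]) auto
      finally have "(\<integral>x. norm (f (n + k0) x) \<partial>M) \<le> e / (2 * A) * A"
        using \<open>0 < e\<close> A by (subst (asm) ennreal_le_iff) auto
      also have "\<dots> < e" using \<open>0 < e\<close> A by simp
      finally show ?thesis by (simp add: integral_nonneg_AE)
    qed
    then show "\<exists>n0. \<forall>n\<ge>n0. norm ((\<integral>x. norm (f (n + k0) x) \<partial>M) - 0) < e" by blast
  qed
  obtain r :: "nat \<Rightarrow> nat" where r: "strict_mono r" "AE x in M. (\<lambda>n. f (r n + k0) x) \<longlonglongrightarrow> 0"
    using tendsto_L1_AE_subseq[of M "\<lambda>n. f (n + k0)", OF int lim] by blast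
  have "strict_mono (\<lambda>n. r n + k0)" using r(1) by (simp add: strict_mono_def)
  then show ?thesis using that r(2) by blast
qed

section \<open>Compactness\<close>

text \<open>On a null cell the bound on \<open>q i\<close> is \<open>c\<close>, because \<open>1 / 0 = 0\<close>.\<close>

lemma step_approximation:
  fixes M :: "'x::metric_space measure" and u :: "'x \<Rightarrow> 'y" and I :: "'x \<Rightarrow> nat"
  assumes fin: "finite_measure M" and N: "N_function \<Phi>"
    and u: "u \<in> measurable M (borel_of_metric Y)" and y: "y \<in> mspace Y"
    and g: "g \<in> borel_measurable M" and nn: "\<And>x. x \<in> space M \<Longrightarrow> 0 \<le> g x" and S: "S \<in> null_sets M"
    and haj: "\<And>x x'. x \<in> space M - S \<Longrightarrow> x' \<in> space M - S \<Longrightarrow> mdist Y (u x) (u x') \<le> dist x x' * (g x + g x')"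
    and I: "I \<in> measurable M (count_space UNIV)" and In: "\<And>x. x \<in> space M \<Longrightarrow> I x < n"
    and Id: "\<And>x x'. x \<in> space M \<Longrightarrow> x' \<in> space M \<Longrightarrow> I x = I x' \<Longrightarrow> dist x x' \<le> \<epsilon>"
    and c: "0 < c" and \<epsilon>: "0 < \<epsilon>"
    and gm: "modular M \<Phi> g c \<le> ennreal (1/2)" and um: "modular M \<Phi> (\<lambda>x. mdist Y y (u x)) c \<le> ennreal (1/2)"
  shows "\<exists>q :: nat \<Rightarrow> 'y. (\<forall>i. q i \<in> mspace Y) \<and>
     (\<forall>i. mdist Y y (q i) \<le> c * (1 + 1 / (\<Phi> 1 * measure M {x \<in> space M. I x = i}))) \<and>
     modular M \<Phi> (\<lambda>x. mdist Y (u x) (q (I x))) (2 * c * \<epsilon>) \<le> 1"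
proof -
  interpret finite_measure M by fact
  note [measurable] = N_function_measurable[OF N] g I measurable_mdist_const[OF u]
  have \<Phi>1: "0 < \<Phi> 1" by (rule N_function_pos[OF N]) simp
  have \<Phi>nn: "0 \<le> \<Phi> t" for t by (rule N_function_nonneg[OF N])
  have half_sum: "ennreal (1/2 * a + 1/2 * b) = ennreal (1/2) * ennreal a + ennreal (1/2) * ennreal b"
    if "0 \<le> a" "0 \<le> b" for a b
  proof -
    have "ennreal (1/2 * a + 1/2 * b) = ennreal (1/2 * a) + ennreal (1/2 * b)"
      using that by (intro ennreal_plus) auto
    moreover have "ennreal (1/2 * t) = ennreal (1/2) * ennreal t" if "0 \<le> t" for t
      using that by (intro ennreal_mult) auto
    ultimately show ?thesis using that by (simp only:)
  qed
  have uY: "u x \<in> mspace Y" if "x \<in> space M" for x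
    using measurable_space[OF u that] by simp
  \<comment> \<open>One point per cell has to control both the gradient and the distance to
    \<open>y\<close>, so the sum of the two integrands is averaged. Both modulars are at most 1/2,
    which keeps the integral of \<open>G\<close> at most 1.\<close>
  define G where "G x = \<Phi> (\<bar>g x\<bar> / c) + \<Phi> (\<bar>mdist Y y (u x)\<bar> / c)" for x
  define Q where "Q i = {x \<in> space M. I x = i}" for i
  have G_nn: "0 \<le> G x" for x by (simp add: G_def \<Phi>nn)
  have G_meas [measurable]: "G \<in> borel_measurable M"
    unfolding G_def using y by measurable
  have Q_sets [measurable]: "Q i \<in> sets M" for i unfolding Q_def by measurable
  define T where "T i = (\<integral>\<^sup>+x. ennreal (G x) * indicator (Q i) x \<partial>M)" for i
  define R where "R i = (\<integral>\<^sup>+x. ennreal (\<Phi> (\<bar>g x\<bar> / c)) * indicator (Q i) x \<partial>M)" for i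
  have split: "(\<integral>\<^sup>+x. f x \<partial>M) = (\<Sum>i<n. \<integral>\<^sup>+x. f x * indicator (Q i) x \<partial>M)"
    if [measurable]: "f \<in> borel_measurable M" for f :: "'x \<Rightarrow> ennreal"
  proof -
    have "(\<integral>\<^sup>+x. f x \<partial>M) = (\<integral>\<^sup>+x. (\<Sum>i<n. f x * indicator (Q i) x) \<partial>M)"
    proof (rule nn_integral_cong)
      fix x assume x: "x \<in> space M"
      have "(\<Sum>i<n. f x * indicator (Q i) x) = (\<Sum>i<n. if i = I x then f x else 0)"
        using x by (intro sum.cong) (auto simp: Q_def indicator_def)
      then show "f x = (\<Sum>i<n. f x * indicator (Q i) x)" using In[OF x] by simp
    qed
    also have "\<dots> = (\<Sum>i<n. \<integral>\<^sup>+x. f x * indicator (Q i) x \<partial>M)"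
      by (rule nn_integral_sum) measurable
    finally show ?thesis .
  qed
  have G_int: "(\<integral>\<^sup>+x. ennreal (G x) \<partial>M) \<le> 1"
  proof -
    have "(\<integral>\<^sup>+x. ennreal (G x) \<partial>M) = modular M \<Phi> g c + modular M \<Phi> (\<lambda>x. mdist Y y (u x)) c"
      unfolding modular_def G_def using y
      by (subst nn_integral_add[symmetric]) (auto simp: \<Phi>nn)
    also have "\<dots> \<le> ennreal (1/2) + ennreal (1/2)" by (intro add_mono gm um)
    also have "\<dots> = 1" by (subst ennreal_plus[symmetric]) auto
    finally show ?thesis .
  qed
  have T_le: "T i \<le> 1" for i
    unfolding T_def by (rule order_trans[OF nn_integral_mono G_int]) (auto simp: indicator_def)
  define good where "good i q \<longleftrightarrow> q \<in> mspace Y \<and> mdist Y y q \<le> c * (1 + 1 / (\<Phi> 1 * measure M (Q i))) \<and>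
      (\<integral>\<^sup>+x. ennreal (\<Phi> (\<bar>mdist Y (u x) q\<bar> / (2 * c * \<epsilon>))) * indicator (Q i) x \<partial>M)
        \<le> ennreal (1/2) * R i + ennreal (1/2) * T i" for i q
  have "\<exists>q. good i q" for i
  proof (cases "measure M (Q i) = 0")
    case True
    then have "Q i \<in> null_sets M" by (simp add: emeasure_eq_measure null_setsI)
    then have "(\<integral>\<^sup>+x. ennreal (\<Phi> (\<bar>mdist Y (u x) y\<bar> / (2 * c * \<epsilon>))) * indicator (Q i) x \<partial>M) = 0"
      by (rule nn_integral_null_set)
    then show ?thesis using True y c by (intro exI[of _ y]) (simp add: good_def mdist_self)
  next
    case False
    define m where "m = measure M (Q i)"
    define \<tau> where "\<tau> = enn2real (T i)"
    have m: "0 < m" using False by (simp add: m_def zero_less_measure_iff)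
    have T: "T i = ennreal \<tau>" and \<tau>: "0 \<le> \<tau>" "\<tau> \<le> 1"
      using T_le[of i] by (auto simp: \<tau>_def enn2real_leI order_le_less_trans[OF _ ennreal_one_less_top])
    \<comment> \<open>The average of \<open>G\<close> over the cell is \<open>\<tau> / m\<close>; if
      \<open>G\<close> exceeded it almost everywhere on the cell, its integral there would be too
      large.\<close>
    have "\<exists>x \<in> Q i - S. G x \<le> \<tau> / m"
    proof (rule ccontr)
      assume "\<not> ?thesis"
      then have gt: "\<tau> / m < G x" if "x \<in> Q i - S" for x using that by force
      have const: "(\<integral>\<^sup>+x. ennreal (\<tau> / m) * indicator (Q i) x \<partial>M) = T i"
      proof -
        have "(\<integral>\<^sup>+x. ennreal (\<tau> / m) * indicator (Q i) x \<partial>M) = ennreal (\<tau> / m) * ennreal m"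
          by (subst nn_integral_cmult_indicator) (auto simp: emeasure_eq_measure m_def)
        also have "\<dots> = ennreal (\<tau> / m * m)" using m \<tau> by (subst ennreal_mult) auto
        finally show ?thesis using m T by simp
      qed
      have "(\<integral>\<^sup>+x. ennreal (\<tau> / m) * indicator (Q i) x \<partial>M) < (\<integral>\<^sup>+x. ennreal (G x) * indicator (Q i) x \<partial>M)"
      proof (rule nn_integral_less)
        show "(\<integral>\<^sup>+x. ennreal (\<tau> / m) * indicator (Q i) x \<partial>M) \<noteq> \<infinity>" unfolding const T by simp
        show "AE x in M. ennreal (\<tau> / m) * indicator (Q i) x \<le> ennreal (G x) * indicator (Q i) x"
          using AE_not_in[OF S]
        proof eventually_elim
          case (elim x)
          then show ?case using gt[of x] by (cases "x \<in> Q i") (auto intro: ennreal_leI)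
        qed
        show "\<not> (AE x in M. ennreal (G x) * indicator (Q i) x \<le> ennreal (\<tau> / m) * indicator (Q i) x)"
        proof
          assume "AE x in M. ennreal (G x) * indicator (Q i) x \<le> ennreal (\<tau> / m) * indicator (Q i) x"
          then have "AE x in M. x \<notin> Q i"
            using AE_not_in[OF S]
          proof eventually_elim
            case (elim x)
            show ?case
            proof
              assume "x \<in> Q i"
              then have "\<tau> / m < G x" "ennreal (G x) \<le> ennreal (\<tau> / m)" using gt[of x] elim by auto
              then show False using m \<tau> by (subst (asm) ennreal_le_iff) auto
            qed
          qed
          then have "emeasure M (Q i) = 0" using Q_sets by (subst (asm) AE_iff_null_sets[symmetric]) auto
          then show False using False by (simp add: measure_def)
        qed
      qed measurable
      then show False unfolding const T_def by simp
    qed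
    then obtain z where z: "z \<in> Q i" "z \<notin> S" and Gz: "G z \<le> \<tau> / m" by blast
    have zM: "z \<in> space M" "I z = i" using z by (auto simp: Q_def)
    \<comment> \<open>As \<open>\<tau> \<le> 1\<close>, the chosen point has
      \<open>G z \<le> 1 / m\<close>. The resulting bound involves only \<open>c\<close>,
      \<open>\<Phi>\<close> and the measure of the cell, neither \<open>u\<close> nor
      \<open>g\<close>.\<close>
    have "mdist Y y (u z) / c \<le> 1 + \<Phi> (mdist Y y (u z) / c) / \<Phi> 1"
      using c by (intro N_function_linear_bound[OF N]) auto
    also have "\<dots> \<le> 1 + (1 / m) / \<Phi> 1"
    proof -
      have "\<Phi> (mdist Y y (u z) / c) \<le> G z" by (simp add: G_def \<Phi>nn)
      also have "\<dots> \<le> 1 / m" using Gz \<tau> m by (meson divide_right_mono less_imp_le order_trans)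
      finally show ?thesis using \<Phi>1 by (intro add_left_mono divide_right_mono) auto
    qed
    finally have "mdist Y y (u z) \<le> c * (1 + 1 / (\<Phi> 1 * m))"
      using c by (simp add: pos_divide_le_eq mult.commute)
    moreover have "(\<integral>\<^sup>+x. ennreal (\<Phi> (\<bar>mdist Y (u x) (u z)\<bar> / (2 * c * \<epsilon>))) * indicator (Q i) x \<partial>M)
        \<le> ennreal (1/2) * R i + ennreal (1/2) * T i"
    proof -
      have "(\<integral>\<^sup>+x. ennreal (\<Phi> (\<bar>mdist Y (u x) (u z)\<bar> / (2 * c * \<epsilon>))) * indicator (Q i) x \<partial>M)
        \<le> (\<integral>\<^sup>+x. ennreal (1/2) * (ennreal (\<Phi> (\<bar>g x\<bar> / c)) * indicator (Q i) x)
            + ennreal (1/2) * (ennreal (\<tau> / m) * indicator (Q i) x) \<partial>M)"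
      proof (rule nn_integral_mono_AE, use AE_not_in[OF S] in eventually_elim)
        case (elim x)
        show ?case
        proof (cases "x \<in> Q i")
          case True
          then have xM: "x \<in> space M" "I x = i" by (auto simp: Q_def)
          have "mdist Y (u x) (u z) \<le> dist x z * (g x + g z)"
            using elim z xM zM by (intro haj) auto
          also have "\<dots> \<le> \<epsilon> * (g x + g z)"
            using Id[OF xM(1) zM(1)] xM zM nn by (intro mult_right_mono) auto
          \<comment> \<open>The radius \<open>2 * c * \<epsilon>\<close> turns the Hajlasz bound
            into the midpoint of \<open>g x / c\<close> and \<open>g z / c\<close>. Convexity then
            separates the gradient at \<open>x\<close> from its value at \<open>z\<close>, which the
            average of \<open>G\<close> controls.\<close>
          finally have "\<bar>mdist Y (u x) (u z)\<bar> / (2 * c * \<epsilon>) \<le> (\<bar>g x\<bar> + \<bar>g z\<bar>) / (c + c)"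
            using c \<epsilon> nn[OF xM(1)] nn[OF zM(1)] by (simp add: field_simps)
          then have "\<Phi> (\<bar>mdist Y (u x) (u z)\<bar> / (2 * c * \<epsilon>)) \<le> \<Phi> ((\<bar>g x\<bar> + \<bar>g z\<bar>) / (c + c))"
            using c \<epsilon> by (intro N_function_mono[OF N]) auto
          also have "\<dots> \<le> c / (c + c) * \<Phi> (\<bar>g x\<bar> / c) + c / (c + c) * \<Phi> (\<bar>g z\<bar> / c)"
            by (rule N_function_weighted[OF N c c])
          also have "c / (c + c) = 1/2" using c by simp
          also have "1/2 * \<Phi> (\<bar>g x\<bar> / c) + 1/2 * \<Phi> (\<bar>g z\<bar> / c) \<le> 1/2 * \<Phi> (\<bar>g x\<bar> / c) + 1/2 * (\<tau> / m)"
            using Gz \<Phi>nn[of "\<bar>mdist Y y (u z)\<bar> / c"] by (simp add: G_def)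
          finally have "ennreal (\<Phi> (\<bar>mdist Y (u x) (u z)\<bar> / (2 * c * \<epsilon>)))
              \<le> ennreal (1/2 * \<Phi> (\<bar>g x\<bar> / c) + 1/2 * (\<tau> / m))"
            by (rule ennreal_leI)
          also have "\<dots> = ennreal (1/2) * ennreal (\<Phi> (\<bar>g x\<bar> / c)) + ennreal (1/2) * ennreal (\<tau> / m)"
            using \<tau> m \<Phi>nn by (intro half_sum) auto
          finally show ?thesis using True by simp
        qed simp
      qed
      also have "\<dots> = ennreal (1/2) * R i + ennreal (1/2) * (\<integral>\<^sup>+x. ennreal (\<tau> / m) * indicator (Q i) x \<partial>M)"
      proof -
        have "(\<integral>\<^sup>+x. ennreal (1/2) * (f x * indicator (Q i) x) \<partial>M) = ennreal (1/2) * (\<integral>\<^sup>+x. f x * indicator (Q i) x \<partial>M)"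
          if [measurable]: "f \<in> borel_measurable M" for f
          by (rule nn_integral_cmult) measurable
        then show ?thesis
          unfolding R_def by (subst nn_integral_add) simp_all
      qed
      also have "(\<integral>\<^sup>+x. ennreal (\<tau> / m) * indicator (Q i) x \<partial>M) = ennreal (\<tau> / m) * ennreal m"
        by (subst nn_integral_cmult_indicator) (auto simp: emeasure_eq_measure m_def)
      also have "\<dots> = T i" using m \<tau> T by (subst ennreal_mult[symmetric]) auto
      finally show ?thesis .
    qed
    ultimately show ?thesis using uY[OF zM(1)] by (intro exI[of _ "u z"]) (simp add: good_def m_def)
  qed
  then obtain q where "\<And>i. good i (q i)" by metis
  then have q: "\<And>i. q i \<in> mspace Y"
      "\<And>i. mdist Y y (q i) \<le> c * (1 + 1 / (\<Phi> 1 * measure M (Q i)))"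
      "\<And>i. (\<integral>\<^sup>+x. ennreal (\<Phi> (\<bar>mdist Y (u x) (q i)\<bar> / (2 * c * \<epsilon>))) * indicator (Q i) x \<partial>M)
        \<le> ennreal (1/2) * R i + ennreal (1/2) * T i"
    by (simp_all add: good_def)
  have [measurable]: "(\<lambda>x. mdist Y (u x) (q (I x))) \<in> borel_measurable M"
    by (rule measurable_mdist_countable_valued[OF q(1) I u])
  have "modular M \<Phi> (\<lambda>x. mdist Y (u x) (q (I x))) (2 * c * \<epsilon>)
      = (\<Sum>i<n. \<integral>\<^sup>+x. ennreal (\<Phi> (\<bar>mdist Y (u x) (q (I x))\<bar> / (2 * c * \<epsilon>))) * indicator (Q i) x \<partial>M)"
    unfolding modular_def by (rule split) measurable
  also have "\<dots> = (\<Sum>i<n. \<integral>\<^sup>+x. ennreal (\<Phi> (\<bar>mdist Y (u x) (q i)\<bar> / (2 * c * \<epsilon>))) * indicator (Q i) x \<partial>M)"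
    by (intro sum.cong nn_integral_cong) (auto simp: Q_def indicator_def)
  also have "\<dots> \<le> (\<Sum>i<n. ennreal (1/2) * R i + ennreal (1/2) * T i)"
    by (rule sum_mono) (rule q(3))
  also have "\<dots> = ennreal (1/2) * (\<Sum>i<n. R i) + ennreal (1/2) * (\<Sum>i<n. T i)"
    by (simp only: sum.distrib sum_distrib_left)
  also have "(\<Sum>i<n. R i) = modular M \<Phi> g c"
    unfolding R_def modular_def by (rule split[symmetric]) measurable
  also have "(\<Sum>i<n. T i) = (\<integral>\<^sup>+x. ennreal (G x) \<partial>M)"
    unfolding T_def by (rule split[symmetric]) measurable
  \<comment> \<open>The gradient contributes at most 1/4 and \<open>G\<close> at most 1/2, in total
    3/4.\<close>
  also have "ennreal (1/2) * modular M \<Phi> g c + ennreal (1/2) * (\<integral>\<^sup>+x. ennreal (G x) \<partial>M)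
      \<le> ennreal (1/2) * ennreal (1/2) + ennreal (1/2) * ennreal 1"
    using G_int by (intro add_mono mult_left_mono gm) auto
  also have "\<dots> = ennreal (1/2 * (1/2) + 1/2 * 1)" by (rule half_sum[symmetric]) auto
  also have "\<dots> \<le> ennreal 1" by (rule ennreal_leI) simp
  also have "\<dots> = 1" by simp
  finally show ?thesis using q(1,2) unfolding Q_def by blast
qed

text \<open>At each scale \<open>j\<close> the net points with a given label converge, so all late
  nets are close to the one of some index \<open>k0\<close>. The finitely many nets up to
  \<open>k0\<close> then cover every \<open>T k\<close>.\<close>

lemma compactin_closure_of_uniform_nets:
  fixes Z :: "'z metric" and T :: "nat \<Rightarrow> 'z set" and p :: "nat \<Rightarrow> nat \<Rightarrow> nat \<Rightarrow> 'z" and n :: "nat \<Rightarrow> nat"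
  assumes Z: "mcomplete_of Z" and TZ: "\<And>k. T k \<subseteq> mspace Z"
    and p: "\<And>k j i. p k j i \<in> T k" and net: "\<And>k j. T k \<subseteq> (\<Union>i<n j. mball_of Z (p k j i) ((1/2) ^ j))"
    and \<psi>: "\<And>j i. \<psi> j i \<in> mspace Z" and lim: "\<And>j i. (\<lambda>k. mdist Z (p k j i) (\<psi> j i)) \<longlonglongrightarrow> 0"
  shows "compactin (mtopology_of Z) (mtopology_of Z closure_of (\<Union>k. T k))"
proof -
  interpret Z: Metric_space "mspace Z" "mdist Z" by (rule Metric_space_mspace_mdist)
  have "Z.mtotally_bounded (\<Union>k. T k)"
    unfolding Z.mtotally_bounded_def
  proof (intro allI impI)
    fix e :: real assume e: "0 < e"
    obtain j where j: "(1/2::real) ^ j < e / 3" using real_arch_pow_inv[of "e/3" "1/2"] e by auto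
    have "\<forall>\<^sub>F k in sequentially. \<forall>i\<in>{..<n j}. mdist Z (p k j i) (\<psi> j i) < e / 3"
      using e by (intro eventually_ball_finite ballI order_tendstoD(2)[OF lim]) auto
    then obtain k0 where k0: "\<And>k i. k0 \<le> k \<Longrightarrow> i < n j \<Longrightarrow> mdist Z (p k j i) (\<psi> j i) < e / 3"
      by (auto simp: eventually_sequentially)
    define C where "C = (\<lambda>(k, i). p k j i) ` ({..k0} \<times> {..<n j})"
    have "(\<Union>k. T k) \<subseteq> (\<Union>x\<in>C. Z.mball x e)"
    proof
      fix z assume "z \<in> (\<Union>k. T k)"
      then obtain k where k: "z \<in> T k" by blast
      then obtain i where i: "i < n j" "z \<in> mball_of Z (p k j i) ((1/2) ^ j)" using net[of k j] by blast
      then have z: "z \<in> mspace Z" "mdist Z (p k j i) z < e / 3" using j by (auto simp: in_mball_of)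
      have pZ: "p k j i \<in> mspace Z" for k j i using p TZ by blast
      \<comment> \<open>Total boundedness asks for centres in the union itself, where the limit
        points \<open>\<psi> j i\<close> need not lie; the net of index \<open>k0\<close> replaces
        them. Two thirds of \<open>e\<close> pay for the detour through \<open>\<psi> j i\<close>,
        one third for the net.\<close>
      define k' where "k' = min k k0"
      have "mdist Z (p k' j i) z < e"
      proof (cases "k \<le> k0")
        case True
        then show ?thesis using z e by (simp add: k'_def min_absorb1)
      next
        case False
        have "mdist Z (p k0 j i) z \<le> mdist Z (p k0 j i) (\<psi> j i) + (mdist Z (\<psi> j i) (p k j i) + mdist Z (p k j i) z)"
          using mdist_triangle[OF pZ[of k0 j i] \<psi>[of j i] z(1)] mdist_triangle[OF \<psi>[of j i] pZ[of k j i] z(1)]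
          by linarith
        also have "\<dots> < e"
          using k0[of k0 i] k0[of k i] False i(1) z(2) mdist_commute[of Z "\<psi> j i" "p k j i"] by simp
        finally show ?thesis using False by (simp add: k'_def min_absorb2)
      qed
      moreover have "p k' j i \<in> C" using i(1) by (force simp: C_def k'_def)
      ultimately show "z \<in> (\<Union>x\<in>C. Z.mball x e)" using z(1) pZ by (auto simp: Z.in_mball)
    qed
    moreover have "finite C" "C \<subseteq> (\<Union>k. T k)" using p by (auto simp: C_def)
    ultimately show "\<exists>C. finite C \<and> C \<subseteq> (\<Union>k. T k) \<and> (\<Union>k. T k) \<subseteq> (\<Union>x\<in>C. Z.mball x e)" by blast
  qed
  then show ?thesis
    using Z.mtotally_bounded_eq_compact_closure_of Z by (simp add: mcomplete_of_def mtopology_of_def)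
qed

text \<open>Nets of different sizes are padded with a repeated point to the common length
  \<open>n j\<close>, so that a label \<open>(j, i)\<close> denotes a point in every
  \<open>K m\<close>.\<close>

lemma uniformly_compact_nets:
  assumes unif: "uniformly_compact Y K" and ne: "\<And>m. K m \<noteq> {}"
  obtains n :: "nat \<Rightarrow> nat" and p :: "nat \<Rightarrow> nat \<Rightarrow> nat \<Rightarrow> 'y" where
    "\<And>m j i. p m j i \<in> K m" "\<And>m j. K m \<subseteq> (\<Union>i<n j. mball_of (Y m) (p m j i) ((1/2) ^ j))"
proof -
  define cover where "cover j N \<longleftrightarrow> (\<forall>m. \<exists>C. finite C \<and> card C \<le> N \<and> C \<subseteq> K m \<and>
      K m \<subseteq> (\<Union>c\<in>C. mball_of (Y m) c ((1/2) ^ j)))" for j N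
  have "\<exists>N. cover j N" for j
    using unif unfolding uniformly_compact_def cover_def by simp
  then obtain n where n: "\<And>j. cover j (n j)" by metis
  define net where "net m j q \<longleftrightarrow> (\<forall>i. q i \<in> K m) \<and> K m \<subseteq> (\<Union>i<n j. mball_of (Y m) (q i) ((1/2) ^ j))" for m j q
  have "\<exists>q. net m j q" for m j
  proof -
    obtain C where C: "finite C" "card C \<le> n j" "C \<subseteq> K m" "K m \<subseteq> (\<Union>c\<in>C. mball_of (Y m) c ((1/2) ^ j))"
      using n[of j] unfolding cover_def by (elim allE[of _ m] exE conjE)
    obtain h where h: "bij_betw h {0..<card C} C" using ex_bij_betw_nat_finite[OF C(1)] by blast
    obtain y where y: "y \<in> K m" using ne by blast
    define q where "q i = (if i < card C then h i else y)" for i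
    have qK: "q i \<in> K m" for i using h C(3) y by (auto simp: q_def bij_betw_def)
    have sub: "C \<subseteq> q ` {..<n j}"
    proof
      fix c assume "c \<in> C"
      then have "c \<in> h ` {0..<card C}" using h by (simp add: bij_betw_def)
      then obtain i where "i < card C" "c = h i" by auto
      then show "c \<in> q ` {..<n j}" using C(2) by (auto simp: q_def)
    qed
    have "K m \<subseteq> (\<Union>c\<in>q ` {..<n j}. mball_of (Y m) c ((1/2) ^ j))"
      using C(4) UN_mono[OF sub order_refl] by (rule order_trans)
    with qK show ?thesis by (intro exI[of _ q]) (simp add: net_def)
  qed
  then obtain p where "\<And>m j. net m j (p m j)" by metis
  then show ?thesis by (intro that[of p n]) (auto simp: net_def)
qed

lemma ennreal_finite_less_real:
  assumes "a < (\<infinity>::ennreal)" obtains s where "0 < s" "a < ennreal s"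
proof (cases a)
  case (real t)
  then show ?thesis by (intro that[of "t + 1"]) (auto simp: ennreal_less_iff)
qed (use assms in simp)

theorem theorem3p1:
  fixes \<mu> :: "'x::complete_space measure"
    and \<Omega> :: "'x set"
    and \<Phi> :: "real \<Rightarrow> real"
    and Y :: "nat \<Rightarrow> 'y metric"
    and K :: "nat \<Rightarrow> 'y set"
    and u :: "nat \<Rightarrow> 'x \<Rightarrow> 'y"
  assumes space: "space \<mu> = UNIV" and borel: "sets \<mu> = sets borel"
    and doubling: "doubling_measure \<mu>"
    and domain: "open \<Omega>" "connected \<Omega>" "bounded \<Omega>" "\<Omega> \<noteq> {}"
    and Nfun: "N_function \<Phi>" and Dp: "Delta_prime \<Phi>" and N2: "nabla2 \<Phi>"
    and PI: "supports_Phi_Poincare \<mu> \<Omega> \<Phi>"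
    and Ycomplete: "\<And>m. mcomplete_of (Y m)"
    and Kcompact: "\<And>m. compactin (mtopology_of (Y m)) (K m)"
    and uM: "\<And>m. u m \<in> M1Phi \<mu> \<Omega> \<Phi> (Y m)"
    and unif: "uniformly_compact Y K"
    and bound: "\<exists>y. (\<forall>m. y m \<in> K m) \<and>
       (SUP m. lux_norm \<mu> \<Omega> \<Phi> (\<lambda>x. mdist (Y m) (y m) (u m x)) + E_H \<mu> \<Omega> \<Phi> (Y m) (u m)) < \<infinity>"
  shows "\<exists>(\<sigma>::nat \<Rightarrow> nat) (Z :: ((nat \<times> 'y) \<Rightarrow> real) metric) \<phi> KZ v.
     strict_mono \<sigma> \<and> mcomplete_of Z \<and>
     (\<forall>k. isometric_embedding (Y (\<sigma> k)) Z (\<phi> k)) \<and>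
     compactin (mtopology_of Z) KZ \<and>
     v \<in> M1Phi \<mu> \<Omega> \<Phi> Z \<and>
     (\<forall>k. \<phi> k ` K (\<sigma> k) \<subseteq> KZ) \<and>
     ((\<lambda>k. lux_norm \<mu> \<Omega> \<Phi> (\<lambda>x. mdist Z (\<phi> k (u (\<sigma> k) x)) (v x))) \<longlongrightarrow> 0) sequentially"
proof -

  \<comment> \<open>The domain as a finite measure space\<close>
  have \<Omega>_sets: "\<Omega> \<in> sets \<mu>" using domain(1) by (simp add: borel)
  define M where "M = restrict_space \<mu> \<Omega>"
  have space_M: "space M = \<Omega>" by (simp add: M_def space_restrict_space space)
  have null_M: "S \<in> null_sets M \<longleftrightarrow> S \<subseteq> \<Omega> \<and> S \<in> null_sets \<mu>" for S
    unfolding M_def using \<Omega>_sets by (simp add: null_sets_restrict_space)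
  have fin: "finite_measure M"
  proof
    obtain x0 R where R: "0 < R" "\<Omega> \<subseteq> ball x0 R" using bounded_subset_ballD[OF domain(3), of undefined] by blast
    have "emeasure \<mu> \<Omega> \<le> emeasure \<mu> (ball x0 (2 * (R / 2)))"
      using R by (intro emeasure_mono) (auto simp: borel)
    also have "\<dots> < \<infinity>" using doubling R(1) unfolding doubling_measure_def by (meson half_gt_zero)
    finally show "emeasure M (space M) \<noteq> \<infinity>"
      using \<Omega>_sets by (simp add: space_M M_def emeasure_restrict_space)
  qed
  note lux_le = lux_norm_le[OF \<Omega>_sets, folded M_def]
  note modular_lux = modular_le_one_of_lux_norm[OF Nfun \<Omega>_sets, folded M_def]

  \<comment> \<open>Uniform bounds for the maps and their gradients\<close>
  obtain y where yK: "\<And>m. y m \<in> K m" and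
    SUP: "(SUP m. lux_norm \<mu> \<Omega> \<Phi> (\<lambda>x. mdist (Y m) (y m) (u m x)) + E_H \<mu> \<Omega> \<Phi> (Y m) (u m)) < \<infinity>"
    using bound by blast
  \<comment> \<open>Strictly above the supremum: strictness yields gradients of norm below
    \<open>s\<close> from the infimum \<open>E_H\<close>, and it turns norms into modular bounds at
    radius \<open>s\<close>.\<close>
  obtain s where s: "0 < s"
    "(SUP m. lux_norm \<mu> \<Omega> \<Phi> (\<lambda>x. mdist (Y m) (y m) (u m x)) + E_H \<mu> \<Omega> \<Phi> (Y m) (u m)) < ennreal s"
    using ennreal_finite_less_real[OF SUP] .
  have lt_s: "lux_norm \<mu> \<Omega> \<Phi> (\<lambda>x. mdist (Y m) (y m) (u m x)) + E_H \<mu> \<Omega> \<Phi> (Y m) (u m) < ennreal s" for m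
    by (rule le_less_trans[OF SUP_upper s(2)]) simp
  have u_lux: "lux_norm \<mu> \<Omega> \<Phi> (\<lambda>x. mdist (Y m) (y m) (u m x)) < ennreal s" for m
    by (rule le_less_trans[OF _ lt_s[of m]]) simp
  have "E_H \<mu> \<Omega> \<Phi> (Y m) (u m) < ennreal s" for m
    by (rule le_less_trans[OF _ lt_s[of m]]) simp
  then have "\<exists>g. hajlasz_gradient \<mu> \<Omega> \<Phi> (Y m) (u m) g \<and> lux_norm \<mu> \<Omega> \<Phi> g < ennreal s" for m
    unfolding E_H_def INF_less_iff by auto
  then obtain g where g: "\<And>m. hajlasz_gradient \<mu> \<Omega> \<Phi> (Y m) (u m) (g m)"
    and g_lux: "\<And>m. lux_norm \<mu> \<Omega> \<Phi> (g m) < ennreal s" by metis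
  have g_meas: "g m \<in> borel_measurable M" and g_nn: "x \<in> space M \<Longrightarrow> 0 \<le> g m x" for m x
    using g[of m] by (auto simp: hajlasz_gradient_def in_LPhi_def M_def space_restrict_space)
  define except where "except m S \<longleftrightarrow> S \<in> null_sets \<mu> \<and>
      (\<forall>x \<in> \<Omega> - S. \<forall>x' \<in> \<Omega> - S. mdist (Y m) (u m x) (u m x') \<le> dist x x' * (g m x + g m x'))" for m S
  have "\<exists>S. except m S" for m
    using g[of m] unfolding hajlasz_gradient_def except_def by blast
  then obtain S0 where "\<And>m. except m (S0 m)" by metis
  then have S0: "\<And>m. S0 m \<in> null_sets \<mu>" and
    S0_haj: "\<And>m. \<forall>x \<in> \<Omega> - S0 m. \<forall>x' \<in> \<Omega> - S0 m. mdist (Y m) (u m x) (u m x') \<le> dist x x' * (g m x + g m x')"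
    by (simp_all add: except_def)
  \<comment> \<open>One exceptional null set for all \<open>m\<close>, so that the inequalities can
    later be compared at fixed points.\<close>
  define S where "S = \<Omega> \<inter> (\<Union>m. S0 m)"
  have S: "S \<in> null_sets M"
    unfolding null_M S_def using S0 \<Omega>_sets by (auto intro!: null_set_Int1 null_sets_UN)
  have haj: "mdist (Y m) (u m x) (u m x') \<le> dist x x' * (g m x + g m x')"
    if "x \<in> space M - S" "x' \<in> space M - S" for m x x'
    using S0_haj[of m] that by (auto simp: S_def space_M)
  have u_meas: "u m \<in> measurable M (borel_of_metric (Y m))" for m
    using uM[of m] by (simp add: M1Phi_def in_LPhi_map_def M_def)
  have uY: "u m x \<in> mspace (Y m)" if "x \<in> space M" for m x
    using measurable_space[OF u_meas that] by simp
  have KY: "K m \<subseteq> mspace (Y m)" for m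
    using compactin_subset_topspace[OF Kcompact[of m]] by simp
  have yY: "y m \<in> mspace (Y m)" for m using yK KY by blast
  have yu_meas: "(\<lambda>x. mdist (Y m) (y m) (u m x)) \<in> borel_measurable M" for m
    by (rule measurable_mdist_const[OF u_meas yY])
  define c where "c = 2 * s"
  have c: "0 < c" using s by (simp add: c_def)
  have g_mod: "modular M \<Phi> (g m) s \<le> 1" and u_mod: "modular M \<Phi> (\<lambda>x. mdist (Y m) (y m) (u m x)) s \<le> 1" for m
    by (rule modular_lux[OF g_lux], rule modular_lux[OF u_lux])
  have g_half: "modular M \<Phi> (g m) c \<le> ennreal (1/2)"
    and u_half: "modular M \<Phi> (\<lambda>x. mdist (Y m) (y m) (u m x)) c \<le> ennreal (1/2)" for m
    unfolding c_def by (rule modular_half[OF Nfun g_meas g_mod], rule modular_half[OF Nfun yu_meas u_mod])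

  \<comment> \<open>Step maps and nets with common labels\<close>
  define small_cells where "small_cells j I n \<longleftrightarrow> I \<in> measurable M (count_space UNIV) \<and> (\<forall>x\<in>space M. I x < n) \<and>
      (\<forall>x\<in>space M. \<forall>x'\<in>space M. I x = I x' \<longrightarrow> dist x x' \<le> (1/2) ^ j)" for j and I :: "'x \<Rightarrow> nat" and n
  \<comment> \<open>The cells depend on \<open>j\<close> alone; otherwise a label
    \<open>(j, i)\<close> could not be compared across different \<open>m\<close>.\<close>
  have "\<exists>I n. small_cells j I n" for j
  proof -
    obtain F where F: "finite F" "\<Omega> \<subseteq> (\<Union>x\<in>F. ball x ((1/2) ^ j / 2))"
      using doubling_measure_bounded_imp_finite_net[OF borel doubling domain(3), of "(1/2) ^ j / 2"] by auto
    obtain I :: "'x \<Rightarrow> nat" and n where I: "I \<in> measurable borel (count_space UNIV)"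
      "\<And>x. x \<in> \<Omega> \<Longrightarrow> I x < n" "\<And>x y. x \<in> \<Omega> \<Longrightarrow> y \<in> \<Omega> \<Longrightarrow> I x = I y \<Longrightarrow> dist x y \<le> (1/2) ^ j"
      using finite_net_measurable_partition[OF F] by blast
    have "I \<in> measurable M (count_space UNIV)"
      unfolding M_def using I(1) borel by (intro measurable_restrict_space1) (simp cong: measurable_cong_sets)
    then have "small_cells j I n" using I by (simp add: small_cells_def space_M)
    then show ?thesis by blast
  qed
  then obtain I n where "\<And>j. small_cells j (I j) (n j)" by metis
  then have I: "\<And>j. I j \<in> measurable M (count_space UNIV)"
    and In: "\<And>j x. x \<in> space M \<Longrightarrow> I j x < n j"
    and Id: "\<And>j x x'. x \<in> space M \<Longrightarrow> x' \<in> space M \<Longrightarrow> I j x = I j x' \<Longrightarrow> dist x x' \<le> (1/2) ^ j"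
    by (simp_all add: small_cells_def)
  \<comment> \<open>The bound from \<open>step_approximation\<close>. It is independent of
    \<open>m\<close>, which keeps the mutual distances of the step values bounded in
    \<open>m\<close>.\<close>
  define b where "b j i = c * (1 + 1 / (\<Phi> 1 * measure M {x \<in> space M. I j x = i}))" for j i
  define step where "step m j q \<longleftrightarrow> (\<forall>i. q i \<in> mspace (Y m)) \<and> (\<forall>i. mdist (Y m) (y m) (q i) \<le> b j i) \<and>
     modular M \<Phi> (\<lambda>x. mdist (Y m) (u m x) (q (I j x))) (2 * c * (1/2) ^ j) \<le> 1" for m j q
  have "\<exists>q. step m j q" for m j
    unfolding step_def b_def
    by (rule step_approximation[OF fin Nfun u_meas yY g_meas g_nn S haj I In Id c _ g_half u_half]) auto
  then obtain q where "\<And>m j. step m j (q m j)" by metis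
  then have q: "\<And>m j i. q m j i \<in> mspace (Y m)"
    and qb: "\<And>m j i. mdist (Y m) (y m) (q m j i) \<le> b j i"
    and q_mod: "\<And>m j. modular M \<Phi> (\<lambda>x. mdist (Y m) (u m x) (q m j (I j x))) (2 * c * (1/2) ^ j) \<le> 1"
    by (simp_all add: step_def)
  obtain nK :: "nat \<Rightarrow> nat" and t where t: "\<And>m j i. t m j i \<in> K m"
    and t_net: "\<And>m j. K m \<subseteq> (\<Union>i<nK j. mball_of (Y m) (t m j i) ((1/2) ^ j))"
  proof (rule uniformly_compact_nets[OF unif])
    show "K m \<noteq> {}" for m using yK[of m] by blast
  qed (rule that)
  obtain D where D: "\<forall>m. \<forall>a\<in>K m. \<forall>b\<in>K m. mdist (Y m) a b \<le> D"
    using conjunct1[OF unif[unfolded uniformly_compact_def]] by (elim exE)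

  \<comment> \<open>Gluing along the labelled points\<close>
  define p where "p m l = (case l of Inl (j, i) \<Rightarrow> t m j i | Inr (j, i) \<Rightarrow> q m j i)"
    for m and l :: "(nat \<times> nat) + (nat \<times> nat)"
  have pY: "p m l \<in> mspace (Y m)" for m l
    using subsetD[OF KY t] q by (cases l) (auto simp: p_def split: prod.split)
  \<comment> \<open>The point \<open>y m\<close> is the common reference: net points are near it by
    the diameter bound \<open>D\<close>, step values by \<open>b\<close>.\<close>
  have yp: "\<exists>B. \<forall>m. mdist (Y m) (y m) (p m l) \<le> B" for l
  proof (cases l)
    case (Inl a)
    then show ?thesis using D yK t by (intro exI[of _ D]) (auto simp: p_def split: prod.split)
  next
    case (Inr a)
    then show ?thesis using qb by (intro exI[of _ "b (fst a) (snd a)"]) (auto simp: p_def split: prod.split)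
  qed
  have "\<exists>B. \<forall>m. mdist (Y m) (p m a) (p m b) \<le> B" for a b
  proof -
    obtain A where A: "\<forall>m. mdist (Y m) (y m) (p m a) \<le> A" using yp[of a] ..
    obtain B where B: "\<forall>m. mdist (Y m) (y m) (p m b) \<le> B" using yp[of b] ..
    have "mdist (Y m) (p m a) (p m b) \<le> A + B" for m
      using mdist_triangle[OF pY[of m a] yY[of m] pY[of m b]] mdist_commute[of "Y m" "y m" "p m a"]
        A[rule_format, of m] B[rule_format, of m] by linarith
    then show ?thesis by (intro exI[of _ "A + B"] allI)
  qed
  from gluing_subsequence[of p Y, OF pY this]
  obtain \<sigma> :: "nat \<Rightarrow> nat" and Z :: "(nat \<times> 'y \<Rightarrow> real) metric" and \<phi> \<psi> where
    \<sigma>: "strict_mono \<sigma>" and Z: "mcomplete_of Z" and iso: "\<And>k. isometric_embedding (Y (\<sigma> k)) Z (\<phi> k)"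
    and \<psi>: "\<And>l. \<psi> l \<in> mspace Z" and lim_\<psi>: "\<And>l. (\<lambda>k. mdist Z (\<phi> k (p (\<sigma> k) l)) (\<psi> l)) \<longlonglongrightarrow> 0"
    by blast
  have \<phi>Z: "\<phi> k a \<in> mspace Z" if "a \<in> mspace (Y (\<sigma> k))" for k a
    using iso[of k] that by (auto simp: isometric_embedding_def)
  have \<phi>_dist: "mdist Z (\<phi> k a) (\<phi> k a') = mdist (Y (\<sigma> k)) a a'"
    if "a \<in> mspace (Y (\<sigma> k))" "a' \<in> mspace (Y (\<sigma> k))" for k a a'
    using iso[of k] that by (auto simp: isometric_embedding_def)
  have q_p: "q m j i = p m (Inr (j, i))" and t_p: "t m j i = p m (Inl (j, i))" for m j i
    by (simp_all add: p_def)
  define P where "P j i = \<psi> (Inr (j, i))" for j i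
  have PZ: "P j i \<in> mspace Z" for j i by (simp add: P_def \<psi>)
  have lim_q: "(\<lambda>k. mdist Z (\<phi> k (q (\<sigma> k) j i)) (P j i)) \<longlonglongrightarrow> 0" for j i
    unfolding q_p P_def by (rule lim_\<psi>)
  define f where "f k x = \<phi> k (u (\<sigma> k) x)" for k x
  have f_meas: "f k \<in> measurable M (borel_of_metric Z)" for k
    unfolding f_def by (rule measurable_compose[OF u_meas isometric_embedding_measurable[OF iso]])
  have fZ: "f k x \<in> mspace Z" if "x \<in> space M" for k x
    unfolding f_def using that by (intro \<phi>Z uY)
  define w where "w k j x = \<phi> k (q (\<sigma> k) j (I j x))" for k j x
  have wZ: "w k j x \<in> mspace Z" for k j x unfolding w_def by (intro \<phi>Z q)
  have w_meas: "w k j \<in> measurable M (borel_of_metric Z)" for k j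
    unfolding w_def by (rule measurable_countable_valued[OF \<phi>Z[OF q] I])
  have fw_meas: "(\<lambda>x. mdist Z (f k x) (w k j x)) \<in> borel_measurable M" for k j
    unfolding w_def by (rule measurable_mdist_countable_valued[OF \<phi>Z[OF q] I f_meas])
  have fw_mod: "modular M \<Phi> (\<lambda>x. mdist Z (f k x) (w k j x)) (2 * c * (1/2) ^ j) \<le> 1" for k j
    by (rule order_trans[OF modular_mono[OF Nfun _ order_refl AE_I2] q_mod[of "\<sigma> k" j]])
      (use c in \<open>auto simp: f_def w_def \<phi>_dist uY q\<close>)

  \<comment> \<open>The limit map\<close>
  have cau: "modular M \<Phi> (\<lambda>x. mdist Z (P j (I j x)) (P i (I i x))) (4 * c * (1/2) ^ j) \<le> 1" if "j \<le> i" for i j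
  proof (rule modular_Fatou[OF Nfun])
    show "(\<lambda>x. mdist Z (w k j x) (w k i x)) \<in> borel_measurable M" for k
      unfolding w_def[of k i] by (rule measurable_mdist_countable_valued[OF \<phi>Z[OF q] I w_meas])
    show "AE x in M. (\<lambda>k. mdist Z (w k j x) (w k i x)) \<longlonglongrightarrow> mdist Z (P j (I j x)) (P i (I i x))"
    proof (rule AE_I2)
      fix x show "(\<lambda>k. mdist Z (w k j x) (w k i x)) \<longlonglongrightarrow> mdist Z (P j (I j x)) (P i (I i x))"
        by (rule tendsto_mdist[OF wZ wZ PZ PZ]) (simp_all add: w_def lim_q)
    qed
    \<comment> \<open>The step maps of scales \<open>j\<close> and \<open>i\<close> are compared
      through \<open>f k\<close>, which both approximate at rates independent of \<open>k\<close>.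
      As \<open>j \<le> i\<close>, the radii add up to at most
      \<open>4 * c * (1/2) ^ j\<close>.\<close>
    have tri: "modular M \<Phi> (\<lambda>x. mdist Z (w k j x) (w k i x)) (2 * c * (1/2) ^ j + 2 * c * (1/2) ^ i) \<le> 1" for k
    proof (rule modular_triangle[OF Nfun fw_meas fw_meas _ _ _ fw_mod fw_mod])
      show "AE x in M. \<bar>mdist Z (w k j x) (w k i x)\<bar> \<le> \<bar>mdist Z (f k x) (w k j x)\<bar> + \<bar>mdist Z (f k x) (w k i x)\<bar>"
        using mdist_triangle[OF wZ fZ wZ] mdist_commute[of Z "f k _" "w k j _"] by (intro AE_I2) auto
    qed (use c in auto)
    have "modular M \<Phi> (\<lambda>x. mdist Z (w k j x) (w k i x)) (4 * c * (1/2) ^ j) \<le> 1" for k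
    proof (rule modular_le_one_mono[OF Nfun tri])
      show "0 < 2 * c * (1/2) ^ j + 2 * c * (1/2) ^ i" using c by (simp add: add_pos_pos)
      show "2 * c * (1/2) ^ j + 2 * c * (1/2) ^ i \<le> 4 * c * (1/2) ^ j"
        using c power_decreasing[OF that, of "1/2::real"] by simp
    qed
    then show "\<forall>\<^sub>F k in sequentially. modular M \<Phi> (\<lambda>x. mdist Z (w k j x) (w k i x)) (4 * c * (1/2) ^ j) \<le> 1"
      by simp
  qed (use c in simp)
  obtain v where v_meas: "v \<in> measurable M (borel_of_metric Z)"
    and dv_meas: "\<And>f. f \<in> measurable M (borel_of_metric Z) \<Longrightarrow> (\<lambda>x. mdist Z (f x) (v x)) \<in> borel_measurable M"
    and v_mod: "\<And>j. modular M \<Phi> (\<lambda>x. mdist Z (P j (I j x)) (v x)) (4 * c * (1/2) ^ j) \<le> 1"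
  proof -
    have "0 < 4 * c" using c by simp
    from Orlicz_Cauchy_limit[of M \<Phi> Z P I, OF fin Nfun Z PZ I this cau] that show thesis by blast
  qed
  have vZ: "v x \<in> mspace Z" if "x \<in> space M" for x using measurable_space[OF v_meas that] by simp

  \<comment> \<open>Three errors: from \<open>f k\<close> to its step map, from there to the limit
    step map, and from that to \<open>v\<close>. The first and third have radii of sum
    \<open>6 * c * (1/2) ^ j\<close> for every \<open>k\<close>, so \<open>j\<close> is fixed first;
    the second involves only the finitely many labels \<open>i < n j\<close> and is uniformly small
    for late \<open>k\<close>.\<close>
  have conv: "\<forall>\<^sub>F k in sequentially. modular M \<Phi> (\<lambda>x. mdist Z (f k x) (v x)) e \<le> 1" if e: "0 < e" for e
  proof -
    obtain j where "(1/2::real) ^ j < e / (12 * c)" using real_arch_pow_inv[of "e / (12 * c)" "1/2"] e c by auto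
    then have j: "6 * c * (1/2) ^ j \<le> e / 2" using c by (simp add: field_simps)
    obtain \<delta> where \<delta>: "0 < \<delta>" "\<And>h. (\<And>x. x \<in> space M \<Longrightarrow> \<bar>h x\<bar> \<le> \<delta>) \<Longrightarrow> modular M \<Phi> h (e / 2) \<le> 1"
      using modular_bounded[OF Nfun fin, of "e / 2"] e by auto
    have "\<forall>\<^sub>F k in sequentially. \<forall>i\<in>{..<n j}. mdist Z (\<phi> k (q (\<sigma> k) j i)) (P j i) < \<delta>"
      using \<delta> by (intro eventually_ball_finite ballI order_tendstoD(2)[OF lim_q]) auto
    then show ?thesis
    proof eventually_elim
      case (elim k)
      have wP_mod: "modular M \<Phi> (\<lambda>x. mdist Z (w k j x) (P j (I j x))) (e / 2) \<le> 1"
        using elim In by (intro \<delta>(2)) (auto simp: w_def intro: less_imp_le)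
      have wP_meas: "(\<lambda>x. mdist Z (w k j x) (P j (I j x))) \<in> borel_measurable M"
        by (rule measurable_mdist_countable_valued[OF PZ I w_meas])
      have fP_mod: "modular M \<Phi> (\<lambda>x. mdist Z (f k x) (P j (I j x))) (2 * c * (1/2) ^ j + e / 2) \<le> 1"
      proof (rule modular_triangle[OF Nfun fw_meas[of k j] wP_meas _ _ AE_I2 fw_mod[of k j] wP_mod])
        show "\<bar>mdist Z (f k x) (P j (I j x))\<bar> \<le> \<bar>mdist Z (f k x) (w k j x)\<bar> + \<bar>mdist Z (w k j x) (P j (I j x))\<bar>"
          if "x \<in> space M" for x
          using mdist_triangle[OF fZ[OF that] wZ PZ] by simp
      qed (use c e in auto)
      have fP_meas: "(\<lambda>x. mdist Z (f k x) (P j (I j x))) \<in> borel_measurable M"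
        by (rule measurable_mdist_countable_valued[OF PZ I f_meas])
      have Pv_meas: "(\<lambda>x. mdist Z (P j (I j x)) (v x)) \<in> borel_measurable M"
        by (rule dv_meas[OF measurable_countable_valued[OF PZ I]])
      have tri: "modular M \<Phi> (\<lambda>x. mdist Z (f k x) (v x)) ((2 * c * (1/2) ^ j + e / 2) + 4 * c * (1/2) ^ j) \<le> 1"
      proof (rule modular_triangle[OF Nfun fP_meas Pv_meas _ _ AE_I2 fP_mod v_mod])
        show "\<bar>mdist Z (f k x) (v x)\<bar> \<le> \<bar>mdist Z (f k x) (P j (I j x))\<bar> + \<bar>mdist Z (P j (I j x)) (v x)\<bar>"
          if "x \<in> space M" for x
          using mdist_triangle[OF fZ[OF that] PZ vZ[OF that]] by simp
      qed (use c e in \<open>auto simp: add_pos_pos\<close>)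
      show ?case
      proof (rule modular_le_one_mono[OF Nfun tri])
        show "0 < (2 * c * (1/2) ^ j + e / 2) + 4 * c * (1/2) ^ j" using c e by (simp add: add_pos_pos)
        show "(2 * c * (1/2) ^ j + e / 2) + 4 * c * (1/2) ^ j \<le> e" using j by simp
      qed
    qed
  qed
  have lux_lim: "(\<lambda>k. lux_norm \<mu> \<Omega> \<Phi> (\<lambda>x. mdist Z (\<phi> k (u (\<sigma> k) x)) (v x))) \<longlonglongrightarrow> 0"
  proof (rule order_tendstoI)
    fix a :: ennreal assume "0 < a"
    then obtain a' where a': "0 < a'" "a' < a" using dense by blast
    obtain e where e: "0 < e" "ennreal e < a" using a' by (cases a') auto
    show "\<forall>\<^sub>F k in sequentially. lux_norm \<mu> \<Omega> \<Phi> (\<lambda>x. mdist Z (\<phi> k (u (\<sigma> k) x)) (v x)) < a"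
      using conv[OF e(1)]
    proof eventually_elim
      case (elim k)
      then show ?case using lux_le[OF e(1)] e(2) by (auto simp: f_def intro: le_less_trans)
    qed
  qed simp

  \<comment> \<open>Membership of the limit in the Hajlasz space\<close>
  obtain r :: "nat \<Rightarrow> nat" where r: "strict_mono r" and r_lim: "AE x in M. (\<lambda>i. mdist Z (f (r i) x) (v x)) \<longlonglongrightarrow> 0"
    by (rule modular_convergence_AE_subseq[OF fin Nfun dv_meas[OF f_meas] conv])
  obtain S1 where S1: "S1 \<in> null_sets M" and
    S1_lim: "\<And>x. x \<in> space M - S1 \<Longrightarrow> (\<lambda>i. mdist Z (f (r i) x) (v x)) \<longlonglongrightarrow> 0"
    using r_lim unfolding eventually_ae_filter by blast
  \<comment> \<open>Norm convergence gives pointwise convergence only along the further subsequence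
    \<open>r\<close>; this does no harm, since all gradients share the modular bound at radius
    \<open>s\<close>.\<close>
  have "\<exists>h. \<exists>S' \<in> null_sets M. h \<in> borel_measurable M \<and> (\<forall>x. 0 \<le> h x) \<and> modular M \<Phi> h s \<le> 1 \<and>
     (\<forall>x\<in>space M - S'. \<forall>x'\<in>space M - S'. mdist Z (v x) (v x') \<le> dist x x' * (h x + h x'))"
  proof (rule hajlasz_inequality_limit[OF fin Nfun _ _ s(1)])
    show "g (\<sigma> (r i)) \<in> borel_measurable M" "modular M \<Phi> (g (\<sigma> (r i))) s \<le> 1" for i
      by (rule g_meas, rule g_mod)
    show "0 \<le> g (\<sigma> (r i)) x" if "x \<in> space M" for i x using that by (rule g_nn)
    show "S \<union> S1 \<in> null_sets M" using S S1 by blast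
    fix x x' assume x: "x \<in> space M - (S \<union> S1)" "x' \<in> space M - (S \<union> S1)"
    show "mdist Z (f (r i) x) (f (r i) x') \<le> dist x x' * (g (\<sigma> (r i)) x + g (\<sigma> (r i)) x')" for i
      using x haj[of x x'] by (simp add: f_def \<phi>_dist uY)
    show "(\<lambda>i. mdist Z (f (r i) x) (f (r i) x')) \<longlonglongrightarrow> mdist Z (v x) (v x')"
      using x by (intro tendsto_mdist fZ vZ S1_lim) auto
  qed
  then obtain h S' where S': "S' \<in> null_sets M" and h: "h \<in> borel_measurable M" "\<And>x. 0 \<le> h x" "modular M \<Phi> h s \<le> 1"
    and h_haj: "\<forall>x\<in>space M - S'. \<forall>x'\<in>space M - S'. mdist Z (v x) (v x') \<le> dist x x' * (h x + h x')"
    by blast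
  have "hajlasz_gradient \<mu> \<Omega> \<Phi> Z v h"
    unfolding hajlasz_gradient_def in_LPhi_def
  proof (intro conjI)
    show "lux_norm \<mu> \<Omega> \<Phi> h < \<infinity>"
      using lux_le[OF s(1) h(3)] by (auto intro: le_less_trans)
    show "\<exists>N\<in>null_sets \<mu>. \<forall>x\<in>\<Omega> - N. \<forall>x'\<in>\<Omega> - N. mdist Z (v x) (v x') \<le> dist x x' * (h x + h x')"
      using h_haj S' unfolding null_M space_M by blast
  qed (use h in \<open>auto simp: M_def\<close>)
  moreover have "in_LPhi_map \<mu> \<Omega> \<Phi> Z v"
    unfolding in_LPhi_map_def
  proof (intro conjI)
    show "v ` \<Omega> \<subseteq> mspace Z" using vZ by (auto simp: space_M)
    show "v \<in> measurable (restrict_space \<mu> \<Omega>) (borel_of_metric Z)" using v_meas by (simp add: M_def)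
    \<comment> \<open>The base point for \<open>v\<close> is borrowed from a single map close to it:
      \<open>y (\<sigma> k)\<close> is carried into \<open>Z\<close>, and the radii \<open>s\<close>
      and 1 add up.\<close>
    obtain k where k: "modular M \<Phi> (\<lambda>x. mdist Z (f k x) (v x)) 1 \<le> 1"
      using conv[of 1] by (auto simp: eventually_sequentially)
    define z where "z = \<phi> k (y (\<sigma> k))"
    have z: "z \<in> mspace Z" unfolding z_def by (rule \<phi>Z[OF yY])
    have "modular M \<Phi> (\<lambda>x. mdist Z z (v x)) (s + 1) \<le> 1"
    proof (rule modular_triangle[OF Nfun yu_meas[of "\<sigma> k"] dv_meas[OF f_meas] s(1) _ _ u_mod k])
      show "AE x in M. \<bar>mdist Z z (v x)\<bar> \<le> \<bar>mdist (Y (\<sigma> k)) (y (\<sigma> k)) (u (\<sigma> k) x)\<bar> + \<bar>mdist Z (f k x) (v x)\<bar>"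
      proof (rule AE_I2)
        fix x assume x: "x \<in> space M"
        have "mdist Z z (f k x) = mdist (Y (\<sigma> k)) (y (\<sigma> k)) (u (\<sigma> k) x)"
          unfolding z_def f_def by (rule \<phi>_dist[OF yY uY[OF x]])
        then show "\<bar>mdist Z z (v x)\<bar> \<le> \<bar>mdist (Y (\<sigma> k)) (y (\<sigma> k)) (u (\<sigma> k) x)\<bar> + \<bar>mdist Z (f k x) (v x)\<bar>"
          using mdist_triangle[OF z fZ[OF x] vZ[OF x], of k] by simp
      qed
    qed simp
    then have "lux_norm \<mu> \<Omega> \<Phi> (\<lambda>x. mdist Z z (v x)) < \<infinity>"
      using lux_le[of "s + 1" \<Phi> "\<lambda>x. mdist Z z (v x)"] s(1) by (auto intro: le_less_trans)
    then show "\<exists>y0\<in>mspace Z. lux_norm \<mu> \<Omega> \<Phi> (\<lambda>x. mdist Z y0 (v x)) < \<infinity>" using z by blast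
  qed
  ultimately have v_M1: "v \<in> M1Phi \<mu> \<Omega> \<Phi> Z" unfolding M1Phi_def by blast

  \<comment> \<open>A common compact set for the embedded sets \<open>K (\<sigma> k)\<close>\<close>
  define T where "T k = \<phi> k ` K (\<sigma> k)" for k
  define KZ where "KZ = mtopology_of Z closure_of (\<Union>k. T k)"
  have TZ: "T k \<subseteq> mspace Z" for k unfolding T_def using \<phi>Z KY by blast
  \<comment> \<open>The nets were included among the labels for this purpose: their points converge
    in \<open>Z\<close>, which makes the separate compact sets jointly totally bounded.\<close>
  have "compactin (mtopology_of Z) KZ"
    unfolding KZ_def
  proof (rule compactin_closure_of_uniform_nets[OF Z TZ])
    show "\<phi> k (t (\<sigma> k) j i) \<in> T k" for k j i using t by (simp add: T_def)
    show "(\<lambda>k. mdist Z (\<phi> k (t (\<sigma> k) j i)) (\<psi> (Inl (j, i)))) \<longlonglongrightarrow> 0" for j i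
      unfolding t_p by (rule lim_\<psi>)
    show "T k \<subseteq> (\<Union>i<nK j. mball_of Z (\<phi> k (t (\<sigma> k) j i)) ((1/2) ^ j))" for k j
    proof
      fix z assume "z \<in> T k"
      then obtain a where a: "a \<in> K (\<sigma> k)" "z = \<phi> k a" by (auto simp: T_def)
      then obtain i where i: "i < nK j" "a \<in> mball_of (Y (\<sigma> k)) (t (\<sigma> k) j i) ((1/2) ^ j)"
        using t_net[of "\<sigma> k" j] by blast
      then have "z \<in> mball_of Z (\<phi> k (t (\<sigma> k) j i)) ((1/2) ^ j)"
        by (simp add: a(2) in_mball_of \<phi>Z \<phi>_dist)
      then show "z \<in> (\<Union>i<nK j. mball_of Z (\<phi> k (t (\<sigma> k) j i)) ((1/2) ^ j))" using i(1) by blast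
    qed
  qed (rule \<psi>)
  moreover have "\<phi> k ` K (\<sigma> k) \<subseteq> KZ" for k
  proof -
    have "(\<Union>k. T k) \<subseteq> KZ" unfolding KZ_def using TZ by (intro closure_of_subset) auto
    then show ?thesis by (auto simp: T_def)
  qed
  ultimately show ?thesis
    using \<sigma> Z iso v_M1 lux_lim
    by (intro exI[of _ \<sigma>] exI[of _ Z] exI[of _ \<phi>] exI[of _ KZ] exI[of _ v]) simp
qed

end
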